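(* Let $K$ be an algebraic function field in one variable with constant field $\mathbb{F}_q$, $\infty$ a place of $K$ of odd degree, $A$ the ring of elements of $K$ integral outside $\infty$, $G=GL_2(A)$, $\widehat{G}=GL_2(K)$, $\widetilde{K}=K\cdot\mathbb{F}_{q^2}$, $\widetilde{A}=A\cdot\mathbb{F}_{q^2}$. Let $$M=\begin{pmatrix}a&b\\c&d\end{pmatrix}\in N_{\widehat{G}}(G)$$ with $a,b,c,d\in A$, and let $\mathfrak{q}(M)=aA+bA+cA+dA$. Let $\omega$ be an elliptic element of $G$, and let $\iota:\mathrm{Cl}(A)\to\mathrm{Cl}(\widetilde{A})$ be $[I]\mapsto[I\widetilde{A}]$. Then, in $\mathrm{Cl}(\widetilde{A})$ (in fact in $\ker\overline{N}$), $$[J_{M(\omega)}]=[\iota(\mathfrak{q}(M))\,J_\omega]=\iota([\mathfrak{q}(M)])\,[J_\omega].$$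
   Context: $N_{\widehat{G}}(G)$ is the normalizer of $G$ in $\widehat{G}$. Let $K_\infty$ be the completion of $K$ at $\infty$, $C_\infty$ the completion of an algebraic closure of $K_\infty$, and $\Omega=C_\infty\setminus K_\infty$; $GL_2(K_\infty)$ acts on $\Omega$ by Möbius transformations. An element $\omega\in\Omega$ is elliptic if it is fixed by a non-scalar element of $G$. Fix $\varepsilon\in\mathbb{F}_{q^2}\setminus\mathbb{F}_q$. Every elliptic $\omega$ can be written $\omega=(\varepsilon+s)/t$ with $s,t\in A$ and $t$ dividing $(\overline{\varepsilon}+s)(\varepsilon+s)$, and then $J_\omega:=A(\varepsilon+s)+At$ is an ideal of $\widetilde{A}$ (independent of the choice of $\varepsilon$); $[J]$ denotes the class of an ideal in $\mathrm{Cl}(\widetilde{A})$ or $\mathrm{Cl}(A)$. $\overline{N}:\mathrm{Cl}(\widetilde{A})\to\mathrm{Cl}(A)$ is the norm map $[J]\mapsto[(J\overline{J})\cap A]$, bar denoting the nontrivial automorphism of $\widetilde{K}/K$. *)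

theory Defs
  imports "HOL-Analysis.Analysis" "HOL-Algebra.Algebra" "HOL-Algebra.Algebraic_Closure_Type"
begin

text \<open>
  All fields live inside one ambient field, a type of class \<^class>\<open>field\<close> that plays the role of
  the field $C_\infty$. The constant field, $K$, $K_\infty$, its algebraic closure,
  $\mathbb{F}_{q^2}$ and $\widetilde{K}$ are subsets of it; \<open>subring_of S\<close> views such a
  subset as a ring record.
\<close>

abbreviation ambient :: "'c::field ring"
  where "ambient \<equiv> ring_of_type_algebra"

abbreviation subring_of :: "'c::field set \<Rightarrow> 'c ring"
  where "subring_of S \<equiv> ambient\<lparr>carrier := S\<rparr>"


subsection \<open>Function fields and places\<close>

definition function_field :: "'c::field set \<Rightarrow> 'c set \<Rightarrow> bool"
  where "function_field F K \<longleftrightarrow>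
    subfield F ambient \<and> subfield K ambient \<and> F \<subseteq> K \<and>
    (\<exists>x\<in>K. ring.transcendental ambient F x \<and>
       ring.finite_dimension ambient (generate_field ambient (insert x F)) K)"

definition full_constant_field :: "'c::field set \<Rightarrow> 'c set \<Rightarrow> bool"
  where "full_constant_field F K \<longleftrightarrow> (\<forall>x\<in>K. ring.algebraic ambient F x \<longrightarrow> x \<in> F)"

text \<open>A place of $K/F$ is represented by its valuation ring.\<close>

definition place :: "'c::field set \<Rightarrow> 'c set \<Rightarrow> 'c set \<Rightarrow> bool"
  where "place F K V \<longleftrightarrow>
    subring V ambient \<and> F \<subset> V \<and> V \<subset> K \<and> (\<forall>z\<in>K. z \<in> V \<or> inverse z \<in> V)"

definition place_ideal :: "'c::field set \<Rightarrow> 'c set"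
  where "place_ideal V = V - Units (subring_of V)"

definition has_place_degree :: "'c::field set \<Rightarrow> 'c set \<Rightarrow> nat \<Rightarrow> bool"
  where "has_place_degree F V n \<longleftrightarrow>
    ring.dimension (subring_of V Quot place_ideal V) n
      ((\<lambda>c. place_ideal V +>\<^bsub>subring_of V\<^esub> c) ` F)
      (carrier (subring_of V Quot place_ideal V))"

definition integral_outside :: "'c::field set \<Rightarrow> 'c set \<Rightarrow> 'c set \<Rightarrow> 'c set"
  where "integral_outside F K Vinf = {x\<in>K. \<forall>V. place F K V \<and> V \<noteq> Vinf \<longrightarrow> x \<in> V}"


subsection \<open>Completions\<close>

definition nonarch_absolute_value :: "('c::field \<Rightarrow> real) \<Rightarrow> bool"
  where "nonarch_absolute_value v \<longleftrightarrow>
    (\<forall>x. 0 \<le> v x) \<and> (\<forall>x. v x = 0 \<longleftrightarrow> x = 0) \<and>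
    (\<forall>x y. v (x * y) = v x * v y) \<and> (\<forall>x y. v (x + y) \<le> max (v x) (v y))"

definition is_completion :: "('c::field \<Rightarrow> real) \<Rightarrow> 'c set \<Rightarrow> 'c set \<Rightarrow> bool"
  where "is_completion v L E \<longleftrightarrow>
    subfield L ambient \<and> subfield E ambient \<and> L \<subseteq> E \<and>
    Metric_space.mcomplete E (\<lambda>x y. v (x - y)) \<and>
    Metric_space.mtopology E (\<lambda>x y. v (x - y)) closure_of L = E"


subsection \<open>Quadratic constant field extension\<close>

text \<open>The field with $q^2$ elements, $q = |F|$, inside the algebraically closed ambient field.\<close>

definition quadratic_constants :: "'c::field set \<Rightarrow> 'c set"
  where "quadratic_constants F = {x. x ^ ((card F)\<^sup>2) = x}"

definition nontrivial_automorphism :: "'c::field set \<Rightarrow> 'c set \<Rightarrow> ('c \<Rightarrow> 'c) \<Rightarrow> bool"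
  where "nontrivial_automorphism K L \<sigma> \<longleftrightarrow>
    \<sigma> \<in> ring_iso (subring_of L) (subring_of L) \<and>
    (\<forall>x\<in>K. \<sigma> x = x) \<and> (\<exists>x\<in>L. \<sigma> x \<noteq> x)"


subsection \<open>Ideal classes\<close>

definition ideal_class :: "'c::field set \<Rightarrow> 'c set \<Rightarrow> 'c set set"
  where "ideal_class R I = {J. ideal J (subring_of R) \<and> J \<noteq> {0} \<and>
    (\<exists>x\<in>R - {0}. \<exists>y\<in>R - {0}. x <#\<^bsub>subring_of R\<^esub> I = y <#\<^bsub>subring_of R\<^esub> J)}"

text \<open>
  Operations on classes are given by representatives; the union is over sets that coincide
  whenever the operation is well defined on classes.
\<close>

definition class_group :: "'c::field set \<Rightarrow> 'c set set monoid"
  where "class_group R =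
    \<lparr>carrier = {ideal_class R I | I. ideal I (subring_of R) \<and> I \<noteq> {0}},
     monoid.mult = (\<lambda>C D. \<Union>I\<in>C. \<Union>J\<in>D. ideal_class R (I \<cdot>\<^bsub>subring_of R\<^esub> J)),
     one = ideal_class R R\<rparr>"

definition class_extension :: "'c::field set \<Rightarrow> 'c set set \<Rightarrow> 'c set set"
  where "class_extension R' C = (\<Union>I\<in>C. ideal_class R' (genideal (subring_of R') I))"

definition class_norm ::
    "'c::field set \<Rightarrow> 'c set \<Rightarrow> ('c \<Rightarrow> 'c) \<Rightarrow> 'c set set \<Rightarrow> 'c set set"
  where "class_norm R R' \<sigma> C =
    (\<Union>J\<in>C. ideal_class R ((J \<cdot>\<^bsub>subring_of R'\<^esub> (\<sigma> ` J)) \<inter> R))"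


subsection \<open>Matrices and elliptic elements\<close>

definition matrices2 :: "'c::field set \<Rightarrow> ('c^2^2) monoid"
  where "matrices2 R = \<lparr>carrier = {M. \<forall>i j. M $ i $ j \<in> R}, monoid.mult = (**), one = mat 1\<rparr>"

definition GL2 :: "'c::field set \<Rightarrow> ('c^2^2) monoid"
  where "GL2 R = units_of (matrices2 R)"

definition moebius_action :: "'c::field^2^2 \<Rightarrow> 'c \<Rightarrow> 'c"
  where "moebius_action M \<omega> = (M $ 1 $ 1 * \<omega> + M $ 1 $ 2) / (M $ 2 $ 1 * \<omega> + M $ 2 $ 2)"

text \<open>Here $\Omega$ is the complement of $K_\infty$ in the ambient field.\<close>

definition elliptic :: "'c::field set \<Rightarrow> 'c set \<Rightarrow> 'c \<Rightarrow> bool"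
  where "elliptic A Kinf \<omega> \<longleftrightarrow>
    \<omega> \<notin> Kinf \<and> (\<exists>g\<in>carrier (GL2 A). (\<nexists>k. g = mat k) \<and> moebius_action g \<omega> = \<omega>)"

definition entry_ideal :: "'c::field set \<Rightarrow> 'c^2^2 \<Rightarrow> 'c set"
  where "entry_ideal A M =
    {M $ 1 $ 1 * x + M $ 1 $ 2 * y + M $ 2 $ 1 * z + M $ 2 $ 2 * w | x y z w.
       x \<in> A \<and> y \<in> A \<and> z \<in> A \<and> w \<in> A}"

text \<open>
  The pair \<open>s\<close>, \<open>t\<close> is determined by \<open>\<omega>\<close>, because \<open>1\<close> and \<open>\<epsilon>\<close> are linearly
  independent over $K$.
\<close>

definition elliptic_ideal :: "'c::field set \<Rightarrow> ('c \<Rightarrow> 'c) \<Rightarrow> 'c \<Rightarrow> 'c \<Rightarrow> 'c set"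
  where "elliptic_ideal A \<sigma> \<epsilon> \<omega> =
    (THE J. \<exists>s\<in>A. \<exists>t\<in>A - {0}. \<omega> = (\<epsilon> + s) / t \<and>
       t divides\<^bsub>subring_of A\<^esub> ((\<sigma> \<epsilon> + s) * (\<epsilon> + s)) \<and>
       J = {x * (\<epsilon> + s) + y * t | x y. x \<in> A \<and> y \<in> A})"

end

theory Submission
  imports Defs
begin

text \<open>
  An eigenvalue \<open>l\<close> of a non-scalar matrix in \<open>GL\<^sub>2(A)\<close> fixing \<open>\<omega>\<close> lies outside \<open>K\<^sub>\<infinity>\<close>. By
  completeness its trace is integral at \<open>\<infinity>\<close>, so trace and determinant are constants and
  \<open>l \<in> quadratic_constants F\<close>; this gives \<open>\<omega> = (\<epsilon> + s) / t\<close>. For \<open>M\<close> in the normalizer, conjugation by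
  \<open>M\<close> preserves the full matrix ring over \<open>A\<close>, so \<open>q(M)\<^sup>2 = (det M)\<close>. With \<open>u = \<epsilon> + s\<close>, Cramer's rule
  then yields \<open>q(M) (A u + A t) = A (a u + b t) + A (c u + d t)\<close>, and the right side is a
  multiple of \<open>J\<^bsub>M(\<omega>)\<^esub>\<close>. The classes have trivial norm because \<open>J\<^sub>\<omega>\<close> times its conjugate is
  \<open>(t)\<close> and \<open>q(M)\<^sup>2 = (det M)\<close>.
\<close>

text \<open>Indexing of formal power series would make every matrix entry ambiguous.\<close>

no_notation fps_nth (infixl "$" 75)

subsection \<open>Subrings and ideals of the ambient field\<close>

text \<open>That an element of \<open>A\<close> with \<open>v x \<le> 1\<close> is constant amounts
  to saying that every transcendental element has a pole, so valuation rings must be produced; a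
  maximal subring of \<open>K\<close> avoiding a given element supplies them. Completeness enters
  because a matrix with unit determinant and trace of absolute value above 1 already has its
  eigenvalues in \<open>Kinf\<close>, and with them its fixed points; this is how
  \<open>\<omega> \<notin> Kinf\<close> bounds the trace. On the ideal side the obstacle is that
  generated ideals and products of ideals come without a description by elements. Coordinates
  provide one: \<open>At\<close> is free over \<open>A\<close> on \<open>1\<close> and
  \<open>\<epsilon>\<close>, the ideals involved have the shape \<open>A p1 + A p2\<close> or
  \<open>q + q \<epsilon>\<close>, and the inclusions reduce to coefficient identities together with
  the fact that \<open>det M\<close> divides every product of two entries. That \<open>J\<close>
  times its conjugate equals the ideal of \<open>t\<close>, rather than merely lying in it, comes
  from \<open>\<epsilon>\<close> minus its conjugate being a unit of \<open>At\<close>: constant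
  field extensions are unramified.\<close>

lemma ambient_simps [simp]:
  "carrier ambient = (UNIV :: 'c::field set)"
  "x \<otimes>\<^bsub>ambient\<^esub> y = x * y" "x \<oplus>\<^bsub>ambient\<^esub> y = x + y"
  "\<one>\<^bsub>ambient\<^esub> = (1::'c)" "\<zero>\<^bsub>ambient\<^esub> = (0::'c)"
  by (simp_all add: ring_of_type_algebra_def)

lemma ambient_a_inv [simp]: "\<ominus>\<^bsub>ambient\<^esub> x = - (x::'c::field)"
proof -
  interpret field "ambient :: 'c ring" by rule
  show ?thesis using minus_equality[of "-x" x] by simp
qed

lemma ambient_m_inv [simp]:
  assumes "x \<noteq> (0::'c::field)" shows "inv\<^bsub>ambient\<^esub> x = inverse x"
proof -
  interpret field "ambient :: 'c ring" by rule
  show ?thesis using comm_inv_char[of x "inverse x"] assms by simp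
qed

lemma subring_ambient_iff:
  "subring S ambient \<longleftrightarrow> (1::'c::field) \<in> S \<and> (\<forall>x\<in>S. \<forall>y\<in>S. x - y \<in> S \<and> x * y \<in> S)"
proof -
  interpret field "ambient :: 'c ring" by rule
  show ?thesis
  proof
    assume S: "subring S ambient"
    have "x + - y \<in> S" if "x \<in> S" "y \<in> S" for x y
      using subringE(7)[OF S that(1), of "- y"] subringE(5)[OF S that(2)] by simp
    then show "(1::'c) \<in> S \<and> (\<forall>x\<in>S. \<forall>y\<in>S. x - y \<in> S \<and> x * y \<in> S)"
      using subringE(3,6)[OF S] by simp
  next
    assume S: "(1::'c) \<in> S \<and> (\<forall>x\<in>S. \<forall>y\<in>S. x - y \<in> S \<and> x * y \<in> S)"
    then have z: "0 \<in> S" by (metis diff_self)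
    then have m: "- x \<in> S" if "x \<in> S" for x
      using S that by (metis diff_0)
    have "x + y \<in> S" if "x \<in> S" "y \<in> S" for x y
      using S that m by (metis diff_minus_eq_add)
    then show "subring S ambient"
      using S m by (intro subringI) auto
  qed
qed

context
  fixes S :: "'c::field set"
  assumes S: "subring S ambient"
begin

lemma subring_one: "1 \<in> S"
  and subring_diff: "x \<in> S \<Longrightarrow> y \<in> S \<Longrightarrow> x - y \<in> S"
  and subring_mult: "x \<in> S \<Longrightarrow> y \<in> S \<Longrightarrow> x * y \<in> S"
  using S by (auto simp: subring_ambient_iff)

lemma subring_zero: "0 \<in> S"
  using subring_diff[OF subring_one subring_one] by simp

lemma subring_uminus: "x \<in> S \<Longrightarrow> - x \<in> S"
  using subring_diff[OF subring_zero] by simp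

lemma subring_add: "x \<in> S \<Longrightarrow> y \<in> S \<Longrightarrow> x + y \<in> S"
  using subring_diff[OF _ subring_uminus, of x y] by simp

lemma subring_power: "x \<in> S \<Longrightarrow> x ^ n \<in> S"
  by (induction n) (auto intro: subring_one subring_mult)

lemma subring_sum: "(\<And>i. i \<in> I \<Longrightarrow> f i \<in> S) \<Longrightarrow> sum f I \<in> S"
  by (induction I rule: infinite_finite_induct) (auto intro: subring_zero subring_add)

lemmas subring_intros =
  subring_one subring_zero subring_diff subring_mult subring_uminus subring_add subring_power
  subring_sum

end

lemma subfield_subring: "subfield S ambient \<Longrightarrow> subring S ambient"
  by (simp add: subfield_def subdomain_def subcring_def)

lemma subfield_inverse:
  assumes "subfield S ambient" "(x::'c::field) \<in> S" shows "inverse x \<in> S"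
proof (cases "x = 0")
  case True
  then show ?thesis using assms by simp
next
  case False
  interpret field "ambient :: 'c ring" by rule
  show ?thesis using subfield_m_inv(1)[OF assms(1)] False assms by auto
qed

lemma subfield_divide:
  assumes "subfield S ambient" "(x::'c::field) \<in> S" "y \<in> S" shows "x / y \<in> S"
  using subring_mult[OF subfield_subring[OF assms(1)] assms(2)] subfield_inverse[OF assms(1,3)]
  by (simp add: divide_inverse)

lemma cring_subring_of: "subring R ambient \<Longrightarrow> cring (subring_of R :: 'c::field ring)"
proof -
  assume R: "subring R ambient"
  interpret field "ambient :: 'c ring" by rule
  show ?thesis
    using subcring_iff[of R] subcringI'[OF R] by simp
qed

lemma ideal_subring_of_iff:
  assumes R: "subring R ambient"
  shows "ideal I (subring_of R) \<longleftrightarrow>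
    I \<subseteq> R \<and> (0::'c::field) \<in> I \<and> (\<forall>x\<in>I. \<forall>y\<in>I. x + y \<in> I) \<and> (\<forall>r\<in>R. \<forall>x\<in>I. r * x \<in> I)"
    (is "_ \<longleftrightarrow> ?rhs")
proof -
  interpret R: cring "subring_of R" by (rule cring_subring_of[OF R])
  have inv: "inv\<^bsub>add_monoid (subring_of R)\<^esub> x = - x" if "x \<in> R" for x
    using R.minus_equality[of "-x" x] that subring_uminus[OF R that] by (simp add: a_inv_def)
  show ?thesis
  proof
    assume I: "ideal I (subring_of R)"
    interpret I: ideal I "subring_of R" by (rule I)
    show ?rhs
      using I.Icarr I.zero_closed I.a_closed I.I_l_closed by auto
  next
    assume I: ?rhs
    have "- x \<in> I" if "x \<in> I" for x
    proof -
      have "(- 1) * x \<in> I" using I that subring_uminus[OF R subring_one[OF R]] by blast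
      then show ?thesis by simp
    qed
    then have "subgroup I (add_monoid (subring_of R))"
      using I inv by unfold_locales auto
    moreover have "\<forall>r\<in>R. \<forall>x\<in>I. x * r \<in> I"
      using I by (metis mult.commute)
    ultimately show "ideal I (subring_of R)"
      using I by (intro idealI R.ring_axioms) auto
  qed
qed

lemma l_coset_subring_of: "x <#\<^bsub>subring_of R\<^esub> I = (*) x ` I"
  by (auto simp: l_coset_def)

lemma ideal_prod_mult: "i \<in> I \<Longrightarrow> j \<in> J \<Longrightarrow> i * j \<in> I \<cdot>\<^bsub>subring_of R\<^esub> J"
  using ideal_prod.prod[of i I j J "subring_of R"] by simp

lemma ideal_prod_add:
  "x \<in> I \<cdot>\<^bsub>subring_of R\<^esub> J \<Longrightarrow> y \<in> I \<cdot>\<^bsub>subring_of R\<^esub> J \<Longrightarrow> x + y \<in> I \<cdot>\<^bsub>subring_of R\<^esub> J"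
  using ideal_prod.sum[of x "subring_of R"] by simp

lemma ideal_prod_subsetI:
  assumes "\<And>i j. i \<in> I \<Longrightarrow> j \<in> J \<Longrightarrow> i * j \<in> T" "\<And>x y. x \<in> T \<Longrightarrow> y \<in> T \<Longrightarrow> x + y \<in> T"
  shows "(I \<cdot>\<^bsub>subring_of R\<^esub> J) \<subseteq> T"
proof
  fix z assume "z \<in> I \<cdot>\<^bsub>subring_of R\<^esub> J"
  then show "z \<in> T" by induction (use assms in auto)
qed

text \<open>Well-definedness of class multiplication and of the norm on classes both rest on this: a
  change of representatives alters a product only by a scalar.\<close>

lemma ideal_prod_scale:
  "((*) x ` I) \<cdot>\<^bsub>subring_of R\<^esub> ((*) y ` J) = (*) (x * y) ` (I \<cdot>\<^bsub>subring_of R\<^esub> J)"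
proof
  show "((*) x ` I) \<cdot>\<^bsub>subring_of R\<^esub> ((*) y ` J) \<subseteq> (*) (x * y) ` (I \<cdot>\<^bsub>subring_of R\<^esub> J)"
  proof (rule ideal_prod_subsetI)
    fix i j assume "i \<in> (*) x ` I" "j \<in> (*) y ` J"
    then obtain a b where "a \<in> I" "b \<in> J" "i = x * a" "j = y * b" by auto
    then show "i * j \<in> (*) (x * y) ` (I \<cdot>\<^bsub>subring_of R\<^esub> J)"
      by (intro image_eqI[of _ _ "a * b"]) (auto simp: mult_ac intro: ideal_prod_mult)
  next
    fix u w assume "u \<in> (*) (x * y) ` (I \<cdot>\<^bsub>subring_of R\<^esub> J)" "w \<in> (*) (x * y) ` (I \<cdot>\<^bsub>subring_of R\<^esub> J)"
    then obtain a b where "a \<in> I \<cdot>\<^bsub>subring_of R\<^esub> J" "b \<in> I \<cdot>\<^bsub>subring_of R\<^esub> J"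
      "u = x * y * a" "w = x * y * b" by blast
    then show "u + w \<in> (*) (x * y) ` (I \<cdot>\<^bsub>subring_of R\<^esub> J)"
      by (intro image_eqI[of _ _ "a + b"]) (auto simp: distrib_left intro: ideal_prod_add)
  qed
  have "x * y * z \<in> ((*) x ` I) \<cdot>\<^bsub>subring_of R\<^esub> ((*) y ` J)" if "z \<in> I \<cdot>\<^bsub>subring_of R\<^esub> J" for z
    using that
  proof induction
    case (prod i j)
    have "(x * i) * (y * j) \<in> ((*) x ` I) \<cdot>\<^bsub>subring_of R\<^esub> ((*) y ` J)"
      using prod by (intro ideal_prod_mult) auto
    then show ?case by (simp add: mult_ac)
  next
    case (sum a b)
    then show ?case using ideal_prod_add by (auto simp: distrib_left)
  qed
  then show "(*) (x * y) ` (I \<cdot>\<^bsub>subring_of R\<^esub> J) \<subseteq> ((*) x ` I) \<cdot>\<^bsub>subring_of R\<^esub> ((*) y ` J)"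
    by auto
qed

text \<open>Scalars are absorbed by the left factor alone, so the conjugate of an ideal may stand on
  the right without first being shown to be an ideal.\<close>

lemma ideal_prod_closed_mult:
  assumes "\<And>r i. r \<in> R \<Longrightarrow> i \<in> I \<Longrightarrow> r * i \<in> I" "r \<in> R" "z \<in> I \<cdot>\<^bsub>subring_of R\<^esub> J"
  shows "r * z \<in> I \<cdot>\<^bsub>subring_of R\<^esub> J"
  using assms(3)
proof induction
  case (prod i j)
  then show ?case using ideal_prod_mult[OF assms(1)[OF assms(2)], of i j J R] by (simp add: mult_ac)
next
  case (sum a b)
  then show ?case using ideal_prod_add by (auto simp: distrib_left)
qed

subsection \<open>Ideal classes\<close>

lemma mem_ideal_class_iff:
  "J \<in> ideal_class R I \<longleftrightarrow> ideal J (subring_of R) \<and> J \<noteq> {0} \<and>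
     (\<exists>x\<in>R - {0}. \<exists>y\<in>R - {0}. (*) x ` I = (*) y ` J)"
  unfolding ideal_class_def l_coset_subring_of by blast

lemma ideal_class_eqI:
  fixes R :: "'c::field set"
  assumes R: "subring R ambient" and x: "x \<in> R - {0}" and y: "y \<in> R - {0}"
    and eq: "(*) x ` I = (*) y ` J"
  shows "ideal_class R I = ideal_class R J"
proof -
  have *: "ideal_class R J' \<subseteq> ideal_class R I'"
    if x: "x \<in> R - {0}" and y: "y \<in> R - {0}" and eq: "(*) x ` I' = (*) y ` J'" for x y I' J'
  proof
    fix L assume "L \<in> ideal_class R J'"
    then obtain a b where L: "ideal L (subring_of R)" "L \<noteq> {0}"
      and ab: "a \<in> R - {0}" "b \<in> R - {0}" and e: "(*) a ` J' = (*) b ` L"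
      by (auto simp: mem_ideal_class_iff)
    have "(*) (a * x) ` I' = (*) a ` (*) x ` I'" by (simp add: image_image mult.assoc)
    also have "\<dots> = (*) y ` (*) a ` J'" unfolding eq by (simp add: image_image mult.left_commute)
    also have "\<dots> = (*) (y * b) ` L" unfolding e by (simp add: image_image mult.assoc)
    finally have "(*) (a * x) ` I' = (*) (y * b) ` L" .
    moreover have "a * x \<in> R - {0}" "y * b \<in> R - {0}"
      using subring_mult[OF R] ab x y by auto
    ultimately show "L \<in> ideal_class R I'"
      unfolding mem_ideal_class_iff using L by blast
  qed
  show ?thesis
    using *[OF x y eq] *[OF y x eq[symmetric]] by blast
qed

lemma ideal_class_self:
  fixes R :: "'c::field set"
  assumes "subring R ambient" "ideal I (subring_of R)" "I \<noteq> {0}"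
  shows "I \<in> ideal_class R I"
  using assms subring_one[OF assms(1)] by (auto simp: mem_ideal_class_iff intro!: bexI[of _ 1])

lemma ideal_class_principal:
  fixes R :: "'c::field set"
  assumes "subring R ambient" "w \<in> R - {0}"
  shows "ideal_class R ((*) w ` R) = ideal_class R R"
  using ideal_class_eqI[OF assms(1) _ assms(2), of 1 "(*) w ` R" R] subring_one[OF assms(1)]
  by simp

text \<open>Every pair of representatives yields the same class, so the union in the definition of
  the product collapses; it is nonempty because each nonzero ideal represents its own class.\<close>

lemma class_mult_eq:
  fixes R :: "'c::field set"
  assumes R: "subring R ambient"
    and I: "ideal I (subring_of R)" "I \<noteq> {0}" and J: "ideal J (subring_of R)" "J \<noteq> {0}"
  shows "ideal_class R I \<otimes>\<^bsub>class_group R\<^esub> ideal_class R J = ideal_class R (I \<cdot>\<^bsub>subring_of R\<^esub> J)"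
proof -
  have *: "ideal_class R (I' \<cdot>\<^bsub>subring_of R\<^esub> J') = ideal_class R (I \<cdot>\<^bsub>subring_of R\<^esub> J)"
    if I': "I' \<in> ideal_class R I" and J': "J' \<in> ideal_class R J" for I' J'
  proof -
    obtain x y where xy: "x \<in> R - {0}" "y \<in> R - {0}" "(*) x ` I = (*) y ` I'"
      using I' unfolding mem_ideal_class_iff by blast
    obtain a b where ab: "a \<in> R - {0}" "b \<in> R - {0}" "(*) a ` J = (*) b ` J'"
      using J' unfolding mem_ideal_class_iff by blast
    have "(*) (x * a) ` (I \<cdot>\<^bsub>subring_of R\<^esub> J) = (*) (y * b) ` (I' \<cdot>\<^bsub>subring_of R\<^esub> J')"
      using ideal_prod_scale[where x=x and I=I and y=a and J=J] ideal_prod_scale[where x=y and I=I' and y=b and J=J'] xy ab by simp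
    moreover have "x * a \<in> R - {0}" "y * b \<in> R - {0}"
      using xy ab subring_mult[OF R] by auto
    ultimately show ?thesis using ideal_class_eqI[OF R] by metis
  qed
  have "ideal_class R I \<otimes>\<^bsub>class_group R\<^esub> ideal_class R J =
     (\<Union>I'\<in>ideal_class R I. \<Union>J'\<in>ideal_class R J. ideal_class R (I' \<cdot>\<^bsub>subring_of R\<^esub> J'))"
    by (simp add: class_group_def)
  also have "\<dots> = (\<Union>I'\<in>ideal_class R I. \<Union>J'\<in>ideal_class R J. ideal_class R (I \<cdot>\<^bsub>subring_of R\<^esub> J))"
    using * by auto
  also have "\<dots> = ideal_class R (I \<cdot>\<^bsub>subring_of R\<^esub> J)"
    using ideal_class_self[OF R I] ideal_class_self[OF R J] by auto
  finally show ?thesis .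
qed

lemma genideal_scale:
  fixes R :: "'c::field set"
  assumes R: "subring R ambient" and "I \<subseteq> R" "I' \<subseteq> R" "x \<in> R" "y \<in> R" "y \<noteq> 0"
    and eq: "(*) x ` I = (*) y ` I'"
  shows "(*) x ` genideal (subring_of R) I \<subseteq> (*) y ` genideal (subring_of R) I'"
proof -
  interpret R: cring "subring_of R" by (rule cring_subring_of[OF R])
  have G: "ideal (genideal (subring_of R) I') (subring_of R)"
    using R.genideal_ideal[of I'] assms by simp
  have sub: "I' \<subseteq> genideal (subring_of R) I'"
    using R.genideal_self[of I'] assms by simp
  \<comment> \<open>The elements that \<open>x\<close> carries into \<open>y\<close> times the
    target form an ideal containing \<open>I\<close>, so minimality of the generated ideal gives the
    inclusion without describing its elements.\<close>
  define T where "T = {r \<in> R. x * r \<in> (*) y ` genideal (subring_of R) I'}"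
  have "ideal T (subring_of R)"
    unfolding ideal_subring_of_iff[OF R]
  proof (intro conjI ballI)
    show "T \<subseteq> R" by (auto simp: T_def)
    show "0 \<in> T"
      using G subring_zero[OF R]
      by (auto simp: T_def ideal_subring_of_iff[OF R] intro!: image_eqI[of _ _ 0])
  next
    fix a b assume "a \<in> T" "b \<in> T"
    then obtain c d where "a \<in> R" "b \<in> R" "c \<in> genideal (subring_of R) I'"
      "d \<in> genideal (subring_of R) I'" "x * a = y * c" "x * b = y * d"
      by (auto simp: T_def)
    then show "a + b \<in> T"
      using G subring_add[OF R]
      by (auto simp: T_def ideal_subring_of_iff[OF R] distrib_left intro!: image_eqI[of _ _ "c + d"])
  next
    fix r a assume "r \<in> R" "a \<in> T"
    then obtain c where "a \<in> R" "c \<in> genideal (subring_of R) I'" "x * a = y * c"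
      by (auto simp: T_def)
    moreover from this have "x * (r * a) = y * (r * c)" by (metis mult.left_commute)
    ultimately show "r * a \<in> T"
      using G subring_mult[OF R] \<open>r \<in> R\<close>
      by (auto simp: T_def ideal_subring_of_iff[OF R] intro!: image_eqI[of _ _ "r * c"])
  qed
  moreover have "I \<subseteq> T"
    using sub assms by (fastforce simp: T_def)
  ultimately have "genideal (subring_of R) I \<subseteq> T"
    by (rule R.genideal_minimal)
  then show ?thesis by (auto simp: T_def)
qed

lemma class_extension_eq:
  fixes R R' :: "'c::field set"
  assumes R: "subring R ambient" and R': "subring R' ambient" and sub: "R \<subseteq> R'"
    and I: "ideal I (subring_of R)" "I \<noteq> {0}"
  shows "class_extension R' (ideal_class R I) = ideal_class R' (genideal (subring_of R') I)"
proof -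
  have *: "ideal_class R' (genideal (subring_of R') I') = ideal_class R' (genideal (subring_of R') I)"
    if I': "I' \<in> ideal_class R I" for I'
  proof -
    obtain x y where xy: "x \<in> R - {0}" "y \<in> R - {0}" "(*) x ` I = (*) y ` I'"
      using I' unfolding mem_ideal_class_iff by blast
    have "I \<subseteq> R'" "I' \<subseteq> R'"
      using I I' sub by (auto simp: mem_ideal_class_iff ideal_subring_of_iff[OF R])
    then have "(*) x ` genideal (subring_of R') I = (*) y ` genideal (subring_of R') I'"
      using genideal_scale[OF R', of I I' x y] genideal_scale[OF R', of I' I y x] xy sub by blast
    then show ?thesis
      using ideal_class_eqI[OF R', of x y] xy sub by blast
  qed
  have "class_extension R' (ideal_class R I) =
      (\<Union>I'\<in>ideal_class R I. ideal_class R' (genideal (subring_of R') I))"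
    using * by (auto simp: class_extension_def)
  then show ?thesis using ideal_class_self[OF R I] by auto
qed

subsection \<open>Existence of places\<close>

lemma ambient_pow [simp]: "x [^]\<^bsub>ambient\<^esub> (n::nat) = (x::'c::field) ^ n"
proof -
  interpret field "ambient :: 'c ring" by rule
  show ?thesis by (induction n) (simp_all add: mult.commute)
qed

text \<open>Polynomials over a ring record are lists headed by the leading coefficient, while
  \<open>coeffs\<close> begins with the constant term; hence the \<open>rev\<close>, after which the
  two evaluations agree.\<close>

lemma algebraic_ambientI:
  fixes p :: "'c::field poly"
  assumes "p \<noteq> 0" "\<And>i. Polynomial.coeff p i \<in> F" "poly p x = 0"
  shows "ring.algebraic ambient F x"
proof -
  interpret field "ambient :: 'c ring" by rule
  have ev: "eval (rev xs) x = poly (Poly xs) x" for xs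
    by (induction xs rule: rev_induct) (simp_all add: Poly_snoc poly_monom)
  have "polynomial\<^bsub>ambient\<^esub> F (rev (coeffs p))"
    using assms(1,2) by (auto simp: polynomial_def hd_rev last_coeffs_eq_coeff_degree coeffs_def)
  moreover have "eval (rev (coeffs p)) x = \<zero>\<^bsub>ambient\<^esub>"
    using assms(3) by (simp add: ev)
  ultimately show ?thesis
    using algebraicI[of "rev (coeffs p)" F x] assms(1) by (simp add: univ_poly_carrier over_def)
qed

definition adjoin :: "'c::field set \<Rightarrow> 'c \<Rightarrow> 'c set"
  where "adjoin R z = {poly p z | p. \<forall>i. Polynomial.coeff p i \<in> R}"

lemma adjoinI: "(\<And>i. Polynomial.coeff p i \<in> R) \<Longrightarrow> poly p z \<in> adjoin R z"
  by (auto simp: adjoin_def)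

lemma
  assumes R: "subring R ambient"
  shows subring_adjoin: "subring (adjoin R z) ambient"
    and subset_adjoin: "R \<subseteq> adjoin R z"
    and mem_adjoin: "z \<in> adjoin R z"
proof -
  have "poly p z - poly q z \<in> adjoin R z" "poly p z * poly q z \<in> adjoin R z"
    if "\<forall>i. Polynomial.coeff p i \<in> R" "\<forall>i. Polynomial.coeff q i \<in> R" for p q
    using adjoinI[of "p - q" R z] adjoinI[of "p * q" R z] that
    by (auto simp: coeff_mult intro!: subring_intros[OF R])
  moreover have "poly 1 z \<in> adjoin R z"
    by (rule adjoinI) (auto simp: coeff_1 intro: subring_intros[OF R])
  ultimately show "subring (adjoin R z) ambient"
    by (auto simp: subring_ambient_iff adjoin_def)
  show "R \<subseteq> adjoin R z"
  proof
    fix r assume "r \<in> R"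
    then have "poly [:r:] z \<in> adjoin R z"
      by (intro adjoinI) (auto simp: coeff_pCons split: nat.split intro: subring_intros[OF R])
    then show "r \<in> adjoin R z" by simp
  qed
  have "poly [:0, 1:] z \<in> adjoin R z"
    by (intro adjoinI) (auto simp: coeff_pCons split: nat.split intro: subring_intros[OF R])
  then show "z \<in> adjoin R z" by simp
qed

lemma adjoin_subset:
  assumes "subring S ambient" "R \<subseteq> S" "z \<in> S"
  shows "adjoin R z \<subseteq> S"
  using assms(2,3) by (auto simp: adjoin_def poly_altdef intro!: subring_intros[OF assms(1)])

text \<open>Multiplying \<open>x = poly p (inverse x)\<close> by \<open>x ^ n\<close>, with
  \<open>n\<close> the degree of \<open>p\<close>, makes \<open>x ^ Suc n\<close> equal to the value
  of the reflected polynomial. That polynomial has degree at most \<open>n\<close>, so the leading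
  term of the difference cannot cancel.\<close>

lemma mem_adjoin_inverse_imp_root:
  fixes F :: "'c::field set"
  assumes F: "subring F ambient" and "x \<noteq> 0" "x \<in> adjoin F (inverse x)"
  obtains p where "p \<noteq> 0" "\<And>i. Polynomial.coeff p i \<in> F" "poly p x = 0"
proof -
  obtain p where p: "\<And>i. Polynomial.coeff p i \<in> F" "x = poly p (inverse x)"
    using assms(3) by (auto simp: adjoin_def)
  define n where "n = Polynomial.degree p"
  define r where "r = Polynomial.monom 1 (Suc n) - reflect_poly p"
  have "Polynomial.coeff r (Suc n) = 1"
    by (simp add: r_def coeff_reflect_poly n_def)
  then have "r \<noteq> 0" by auto
  moreover have "Polynomial.coeff r i \<in> F" for i
    using p(1) by (auto simp: r_def coeff_reflect_poly intro: subring_intros[OF F])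
  moreover have "poly r x = 0"
  proof -
    have "poly (reflect_poly p) x = x ^ n * x"
      using poly_reflect_poly_nz[OF \<open>x \<noteq> 0\<close>, of p] p(2) by (simp add: n_def)
    then show ?thesis by (simp add: r_def poly_monom mult.commute)
  qed
  ultimately show ?thesis using that by blast
qed

text \<open>
  The valuation ring is a subring maximal among those containing \<open>F\<close> and \<open>y = 1 / x\<close> but not \<open>x\<close>.
  By maximality \<open>1 - y c\<close> is a unit for all \<open>c\<close>, and if neither \<open>z\<close> nor \<open>1 / z\<close> belongs to it,
  then \<open>1\<close> is a polynomial with coefficients divisible by \<open>y\<close> in each of them; such a pair of
  relations can always be shortened.
\<close>

lemma exists_place_avoiding:
  fixes F K :: "'c::field set"
  assumes F: "subfield F ambient" and K: "subfield K ambient" and FK: "F \<subseteq> K" and xK: "x \<in> K"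
    and tr: "ring.transcendental ambient F x"
  shows "\<exists>V. place F K V \<and> x \<notin> V"
proof -
  note Fr = subfield_subring[OF F] and Kr = subfield_subring[OF K]
  have noroot: False if "p \<noteq> 0" "\<And>i. Polynomial.coeff p i \<in> F" "poly p x = 0" for p
    using algebraic_ambientI[OF that] tr by simp
  have x0: "x \<noteq> 0"
  proof
    assume "x = 0"
    moreover have "Polynomial.coeff [:0, 1:] i \<in> F" for i
      using subring_zero[OF Fr] subring_one[OF Fr] by (auto simp: coeff_pCons split: nat.split)
    ultimately show False using noroot[of "[:0, 1:]"] by simp
  qed
  define y where "y = inverse x"
  have yx: "y * x = 1" and yK: "y \<in> K"
    using x0 subfield_inverse[OF K xK] by (simp_all add: y_def)
  define \<S> where "\<S> = {S. subring S ambient \<and> F \<subseteq> S \<and> y \<in> S \<and> S \<subseteq> K \<and> x \<notin> S}"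
  \<comment> \<open>This makes the Zorn family nonempty: if \<open>x\<close> were a polynomial in
    its own inverse over \<open>F\<close>, it would be algebraic.\<close>
  have "x \<notin> adjoin F y"
    using mem_adjoin_inverse_imp_root[OF Fr x0] noroot unfolding y_def by metis
  then have "adjoin F y \<in> \<S>"
    using subring_adjoin[OF Fr] subset_adjoin[OF Fr] mem_adjoin[OF Fr] adjoin_subset[OF Kr FK yK]
    by (auto simp: \<S>_def)
  moreover have "\<Union>C \<in> \<S>" if C: "C \<noteq> {}" "subset.chain \<S> C" for C
  proof -
    have mem: "S \<in> \<S>" if "S \<in> C" for S using C that by (auto simp: subset.chain_def)
    have op: "a - b \<in> \<Union>C \<and> a * b \<in> \<Union>C" if ab: "a \<in> \<Union>C" "b \<in> \<Union>C" for a b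
    proof -
      obtain S1 S2 where S: "S1 \<in> C" "S2 \<in> C" "a \<in> S1" "b \<in> S2" using ab by blast
      then have "S1 \<subseteq> S2 \<or> S2 \<subseteq> S1" using C(2) unfolding subset.chain_def by blast
      then obtain S where S: "S \<in> C" "a \<in> S" "b \<in> S" using S by blast
      then have "subring S ambient" using mem by (simp add: \<S>_def)
      then show ?thesis using S subring_diff[of S a b] subring_mult[of S a b] by blast
    qed
    obtain S where S: "S \<in> C" using C(1) by blast
    then have "1 \<in> S" using mem[OF S] subring_one[of S] by (simp add: \<S>_def)
    then have "subring (\<Union>C) ambient"
      unfolding subring_ambient_iff using op S by blast
    then show ?thesis using C(1) mem by (auto simp: \<S>_def)
  qed
  ultimately obtain V where V: "V \<in> \<S>" and max: "\<And>S. S \<in> \<S> \<Longrightarrow> V \<subseteq> S \<Longrightarrow> S = V"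
    using subset_Zorn_nonempty[of \<S>] by (metis empty_iff)
  have Vr: "subring V ambient" and FV: "F \<subseteq> V" and yV: "y \<in> V" and VK: "V \<subseteq> K" and xV: "x \<notin> V"
    using V by (auto simp: \<S>_def)
  have adj: "x \<in> adjoin V z" if "z \<in> K" "z \<notin> V" for z
  proof (rule ccontr)
    assume "x \<notin> adjoin V z"
    then have "adjoin V z \<in> \<S>"
      using subring_adjoin[OF Vr] subset_adjoin[OF Vr, of z] adjoin_subset[OF Kr VK that(1)] FV yV
      unfolding \<S>_def by blast
    then show False using max subset_adjoin[OF Vr] mem_adjoin[OF Vr] that(2) by metis
  qed
  have unit: "inverse (1 - y * c) \<in> V" and nz: "1 - y * c \<noteq> 0" if c: "c \<in> V" for c
  proof -
    define u where "u = 1 - y * c"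
    have uV: "u \<in> V" using c yV by (auto simp: u_def intro!: subring_intros[OF Vr])
    show u0: "1 - y * c \<noteq> 0"
    proof
      assume "1 - y * c = 0"
      then have "x = x * (y * c)" by simp
      also have "\<dots> = c" using yx by (simp add: mult_ac)
      finally show False using xV c by simp
    qed
    show "inverse (1 - y * c) \<in> V"
    proof (rule ccontr)
      assume "inverse (1 - y * c) \<notin> V"
      then have "x \<in> adjoin V (inverse u)"
        using adj[of "inverse u"] subfield_inverse[OF K] uV VK by (auto simp: u_def)
      then obtain p where p: "\<And>i. Polynomial.coeff p i \<in> V" "x = poly p (inverse u)"
        by (auto simp: adjoin_def)
      \<comment> \<open>Clearing denominators in \<open>x = poly p (inverse u)\<close> gives
        \<open>u ^ n * x \<in> V\<close>. As \<open>u\<close> is congruent to 1 modulo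
        \<open>y\<close> and \<open>y * x = 1\<close>, the elements \<open>x\<close> and
        \<open>u ^ n * x\<close> differ by some \<open>d\<close> in \<open>V\<close>, which would
        put \<open>x\<close> into \<open>V\<close>.\<close>
      define n where "n = Polynomial.degree p"
      have "poly (reflect_poly p) u \<in> adjoin V u"
        by (rule adjoinI) (auto simp: coeff_reflect_poly p(1) intro: subring_intros[OF Vr])
      then have *: "u ^ n * x \<in> V"
        using adjoin_subset[OF Vr order.refl uV] poly_reflect_poly_nz[of u p] u0 p(2)
        by (auto simp: u_def n_def)
      have "\<exists>d\<in>V. u ^ n = 1 - y * d"
      proof (induction n)
        case 0
        then show ?case using subring_zero[OF Vr] by (auto intro!: bexI[of _ 0])
      next
        case (Suc n)
        then obtain d where d: "d \<in> V" "u ^ n = 1 - y * d" by auto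
        have "u ^ Suc n = 1 - y * (c + d - y * c * d)"
          unfolding power_Suc d(2) by (simp add: u_def algebra_simps)
        moreover have "c + d - y * c * d \<in> V"
          using c d(1) yV by (auto intro!: subring_intros[OF Vr])
        ultimately show ?case by blast
      qed
      then obtain d where d: "d \<in> V" "u ^ n = 1 - y * d" by blast
      have "u ^ n * x = x - (y * x) * d" by (simp add: d(2) algebra_simps)
      then have "x = u ^ n * x + d" using yx by simp
      then show False using subring_add[OF Vr * d(1)] xV by simp
    qed
  qed
  \<comment> \<open>Multiplied by \<open>y\<close>, the relation \<open>x \<in> adjoin V z\<close>
    becomes a representation of 1 whose coefficients are all divisible by \<open>y\<close>; the
    bound \<open>n\<close> is the quantity that descends.\<close>
  define rel where "rel n z \<longleftrightarrow> (\<exists>b. (\<forall>i. b i \<in> V) \<and> 1 = (\<Sum>i\<le>n. y * b i * z ^ i))" for n :: nat and z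
  have relI: "\<exists>n. rel n z" if z: "z \<in> K" "z \<notin> V" for z
  proof -
    obtain p where p: "\<And>i. Polynomial.coeff p i \<in> V" "x = poly p z"
      using adj[OF z] by (auto simp: adjoin_def)
    have "1 = y * poly p z" using p(2) yx by simp
    then have "1 = (\<Sum>i\<le>Polynomial.degree p. y * Polynomial.coeff p i * z ^ i)"
      by (simp add: poly_altdef sum_distrib_left mult.assoc)
    then show ?thesis unfolding rel_def using p(1) by blast
  qed
  have rel0: "\<not> rel 0 z" for z
  proof
    assume "rel 0 z"
    then obtain c where "c \<in> V" "1 = y * c" by (auto simp: rel_def)
    then show False using nz by simp
  qed
  have pad: "rel n z" if "rel m z" "m \<le> n" for m n z
  proof -
    obtain b where b: "\<forall>i. b i \<in> V" "1 = (\<Sum>i\<le>m. y * b i * z ^ i)"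
      using \<open>rel m z\<close> by (auto simp: rel_def)
    have "(\<Sum>i\<le>n. y * (if i \<le> m then b i else 0) * z ^ i) = (\<Sum>i\<le>m. y * b i * z ^ i)"
      using \<open>m \<le> n\<close> by (intro sum.mono_neutral_cong_right) auto
    then show ?thesis
      unfolding rel_def using b subring_zero[OF Vr]
      by (intro exI[of _ "\<lambda>i. if i \<le> m then b i else 0"]) auto
  qed
  \<comment> \<open>The relation in \<open>inverse z\<close>, multiplied by
    \<open>z ^ Suc n\<close>, can be solved for \<open>z ^ Suc n\<close> because
    \<open>1 - y * c 0\<close> is a unit. Substituting the result for the top term of the relation
    in \<open>z\<close> lowers its degree, and the new coefficients stay divisible by
    \<open>y\<close>.\<close>
  have descent: "rel n z" if z: "z \<noteq> 0" and r: "rel (Suc n) z" "rel (Suc n) (inverse z)" for n z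
  proof -
    obtain b where b: "\<And>i. b i \<in> V" "1 = (\<Sum>i\<le>Suc n. y * b i * z ^ i)"
      using r(1) unfolding rel_def by blast
    obtain c where c: "\<And>i. c i \<in> V" "1 = (\<Sum>i\<le>Suc n. y * c i * inverse z ^ i)"
      using r(2) unfolding rel_def by blast
    define w where "w = inverse (1 - y * c 0)"
    have w: "w \<in> V" "w * (1 - y * c 0) = 1" using unit nz c(1) by (auto simp: w_def)
    have "z ^ Suc n = (\<Sum>i\<le>Suc n. y * c i * z ^ (Suc n - i))"
    proof -
      have "z ^ Suc n = z ^ Suc n * (\<Sum>i\<le>Suc n. y * c i * inverse z ^ i)"
        using c(2) by simp
      also have "\<dots> = (\<Sum>i\<le>Suc n. y * c i * (z ^ Suc n * inverse z ^ i))"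
        unfolding sum_distrib_left by (simp only: mult_ac)
      also have "\<dots> = (\<Sum>i\<le>Suc n. y * c i * z ^ (Suc n - i))"
        by (intro sum.cong refl) (simp add: z power_diff power_inverse divide_inverse del: power_Suc)
      finally show ?thesis .
    qed
    also have "\<dots> = y * c 0 * z ^ Suc n + (\<Sum>i\<le>n. y * c (Suc i) * z ^ (n - i))"
      by (subst sum.atMost_Suc_shift) simp
    also have "(\<Sum>i\<le>n. y * c (Suc i) * z ^ (n - i)) = (\<Sum>i\<le>n. y * c (Suc (n - i)) * z ^ i)"
      by (subst sum.nat_diff_reindex[of _ "Suc n", symmetric, unfolded lessThan_Suc_atMost])
        (auto intro!: sum.cong)
    finally have "z ^ Suc n - y * c 0 * z ^ Suc n = (\<Sum>i\<le>n. y * c (Suc (n - i)) * z ^ i)"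
      unfolding diff_eq_eq by (subst add.commute)
    then have "(1 - y * c 0) * z ^ Suc n = (\<Sum>i\<le>n. y * c (Suc (n - i)) * z ^ i)"
      by (simp only: left_diff_distrib mult_1_left)
    then have "w * ((1 - y * c 0) * z ^ Suc n) = w * (\<Sum>i\<le>n. y * c (Suc (n - i)) * z ^ i)"
      by simp
    then have zn: "z ^ Suc n = w * (\<Sum>i\<le>n. y * c (Suc (n - i)) * z ^ i)"
      using w(2) by (metis mult.assoc mult_1)
    have "1 = (\<Sum>i\<le>n. y * b i * z ^ i) + y * b (Suc n) * z ^ Suc n"
      using b(2) by simp
    also have "\<dots> = (\<Sum>i\<le>n. y * b i * z ^ i) +
        (\<Sum>i\<le>n. y * b (Suc n) * (w * (y * c (Suc (n - i)) * z ^ i)))"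
      unfolding zn sum_distrib_left ..
    also have "\<dots> = (\<Sum>i\<le>n. y * (b i + y * b (Suc n) * w * c (Suc (n - i))) * z ^ i)"
      unfolding sum.distrib[symmetric] by (intro sum.cong refl) (simp add: algebra_simps)
    finally show ?thesis
      unfolding rel_def using b(1) c(1) w(1) yV
      by (intro exI[of _ "\<lambda>i. b i + y * b (Suc n) * w * c (Suc (n - i))"])
        (auto intro!: subring_intros[OF Vr])
  qed
  \<comment> \<open>The descent needs both relations at the same bound: the shorter one is padded
    with zeros and the longer one shortened, so \<open>n + m\<close> drops until a relation of
    degree 0 is contradicted.\<close>
  have norel: "\<not> (rel n z \<and> rel m (inverse z))" if "z \<noteq> 0" for n m z
  proof (induction "n + m" arbitrary: n m rule: less_induct)
    case less
    show ?case
    proof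
      assume r: "rel n z \<and> rel m (inverse z)"
      show False
      proof (cases "m \<le> n")
        case True
        obtain k where k: "n = Suc k" using r rel0 by (cases n) auto
        have "rel k z" using descent[OF that, of k] r pad True k by blast
        then show False using less[of k m] r k by auto
      next
        case False
        obtain k where k: "m = Suc k" using r rel0 by (cases m) auto
        have "rel k (inverse z)"
          using descent[of "inverse z" k] that r pad[of n z m] False k by auto
        then show False using less[of n k] r k by auto
      qed
    qed
  qed
  have "z \<in> V \<or> inverse z \<in> V" if "z \<in> K" for z
    using relI[of z] relI[of "inverse z"] norel[of z] that subfield_inverse[OF K that]
      subring_zero[OF Vr] by (cases "z = 0") auto
  \<comment> \<open>A place must contain the constant field strictly; \<open>y\<close> is the
    witness, since \<open>y \<in> F\<close> would bring its inverse \<open>x\<close> into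
    \<open>V\<close>.\<close>
  moreover have "y \<notin> F"
    using subfield_inverse[OF F, of y] FV xV by (auto simp: y_def)
  ultimately have "place F K V"
    using Vr FV yV VK xV xK by (auto simp: place_def)
  then show ?thesis using xV by blast
qed

text \<open>Turns a bound at infinity into membership in \<open>F\<close>: an element of
  \<open>A\<close> with \<open>v x \<le> 1\<close> is integral at infinity too, so it has no pole at
  all.\<close>

lemma constant_of_integral_everywhere:
  assumes "function_field F K" "full_constant_field F K"
    and "x \<in> K" "\<And>V. place F K V \<Longrightarrow> x \<in> V"
  shows "x \<in> F"
proof (rule ccontr)
  assume "x \<notin> F"
  then have "ring.transcendental ambient F x"
    using assms(2,3) by (auto simp: full_constant_field_def)
  then show False
    using exists_place_avoiding[of F K x] assms by (auto simp: function_field_def)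
qed

lemma subring_integral_outside:
  assumes "subfield K ambient"
  shows "subring (integral_outside F K Vinf) ambient"
  using subfield_subring[OF assms]
  by (auto simp: integral_outside_def subring_ambient_iff place_def)

subsection \<open>Quadratic polynomials over a complete field\<close>

lemma nonarch_absolute_valueD:
  assumes "nonarch_absolute_value v"
  shows "0 \<le> v x" "v x = 0 \<longleftrightarrow> x = 0" "v (x * y) = v x * v y" "v (x + y) \<le> max (v x) (v y)"
    "v 1 = 1" "v (- x) = v x" "v (x - y) \<le> max (v x) (v y)" "v (inverse x) = inverse (v x)"
    "v (x - y) = v (y - x)"
proof -
  show *: "0 \<le> v x" "v x = 0 \<longleftrightarrow> x = 0" "v (x * y) = v x * v y" "v (x + y) \<le> max (v x) (v y)" for x y
    using assms by (auto simp: nonarch_absolute_value_def)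
  show 1: "v 1 = 1" using *(3)[of 1 1] *(2)[of 1] by simp
  have "(v (- 1))\<^sup>2 = 1" using *(3)[of "- 1" "- 1"] 1 by (simp add: power2_eq_square)
  then have "v (- 1) = 1" using *(1)[of "- 1"] by (simp add: power2_eq_1_iff)
  then show m: "v (- x) = v x" for x using *(3)[of "- 1" x] by simp
  show "v (x - y) \<le> max (v x) (v y)" using *(4)[of x "- y"] m by simp
  show "v (x - y) = v (y - x)" using m[of "x - y"] by simp
  show "v (inverse x) = inverse (v x)"
  proof (cases "x = 0")
    case True
    then show ?thesis using *(2)[of 0] by simp
  next
    case False
    then have "v x * v (inverse x) = 1" using *(3)[of x "inverse x"] 1 by simp
    then show ?thesis using inverse_unique by metis
  qed
qed

text \<open>Isosceles principle: writing \<open>y\<close> as \<open>(y - x) + x\<close>, the summand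
  \<open>x\<close> is too small to account for \<open>v y\<close>.\<close>

lemma nonarch_dominant:
  assumes v: "nonarch_absolute_value v" and "v x < v y"
  shows "v (y - x) = v y"
  using nonarch_absolute_valueD(7)[OF v, of y x] nonarch_absolute_valueD(4)[OF v, of "y - x" x] assms
  by auto

lemma Metric_space_nonarch:
  assumes v: "nonarch_absolute_value v"
  shows "Metric_space E (\<lambda>x y. v (x - y))"
proof
  fix x y z
  show "0 \<le> v (x - y)" by (rule nonarch_absolute_valueD[OF v])
  show "v (x - y) = v (y - x)" by (rule nonarch_absolute_valueD[OF v])
  show "v (x - y) = 0 \<longleftrightarrow> x = y" by (simp add: nonarch_absolute_valueD(2)[OF v])
  show "v (x - z) \<le> v (x - y) + v (y - z)"
    using nonarch_absolute_valueD(4)[OF v, of "x - y" "y - z"] nonarch_absolute_valueD(1)[OF v]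
    by (smt (verit) diff_add_cancel add_diff_eq max_def)
qed

text \<open>
  If the trace is large, then \<open>x \<mapsto> D / (T - x)\<close> contracts the unit ball, and its fixed point is a
  root. Sending everything outside the ball to \<open>0\<close> makes it a contraction of the whole field.
\<close>

lemma root_in_complete_field:
  fixes v :: "'c::field \<Rightarrow> real"
  assumes v: "nonarch_absolute_value v" and E: "subfield E ambient"
    and complete: "Metric_space.mcomplete E (\<lambda>x y. v (x - y))"
    and "T \<in> E" "D \<in> E" "v D = 1" "v T > 1"
  obtains \<rho> where "\<rho> \<in> E" "\<rho> * (T - \<rho>) = D"
proof -
  note vD = nonarch_absolute_valueD[OF v]
  note Er = subfield_subring[OF E]
  interpret Metric_space E "\<lambda>x y. v (x - y)" by (rule Metric_space_nonarch[OF v])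
  define f where "f x = (if v x \<le> 1 then D / (T - x) else 0)" for x
  have vT: "v (T - x) = v T" if "v x \<le> 1" for x
    using nonarch_dominant[OF v, of x T] that assms by simp
  have v0: "v 0 = 0" using vD(2) by simp
  have nz: "T - x \<noteq> 0" if "v x \<le> 1" for x
    using vT[OF that] assms(7) v0 by auto
  have vf: "v (f x) = inverse (v T)" if "v x \<le> 1" for x
    using that vT[OF that] by (simp add: f_def divide_inverse vD assms)
  \<comment> \<open>A point inside the unit ball and one outside are more than 1 apart, so the jump
    of \<open>f\<close> between the two regions, of size \<open>inverse (v T)\<close>, respects the
    contraction bound.\<close>
  have large: "v (x - y) > 1" if "v x \<le> 1" "\<not> v y \<le> 1" for x y
    using nonarch_dominant[OF v, of x y] that vD(9) by simp
  have "v (f x - f y) \<le> inverse (v T) * v (x - y)" for x y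
  proof -
    consider "v x \<le> 1" "v y \<le> 1" | "v x \<le> 1" "\<not> v y \<le> 1" | "\<not> v x \<le> 1" "v y \<le> 1"
      | "\<not> v x \<le> 1" "\<not> v y \<le> 1" by blast
    then show ?thesis
    proof cases
      case 1
      have "f x - f y = D * (x - y) * (inverse (T - x) * inverse (T - y))"
        using 1 nz[of x] nz[of y] by (simp add: f_def field_simps)
      then have "v (f x - f y) = inverse (v T) * v (x - y) * inverse (v T)"
        using 1 by (simp add: vD vT assms)
      also have "\<dots> \<le> inverse (v T) * v (x - y) * 1"
        using assms vD(1)[of "x - y"] by (intro mult_left_mono) (auto simp: field_simps)
      finally show ?thesis by simp
    next
      case 2
      then have "v (f x - f y) = inverse (v T)" using vf by (simp add: f_def)
      then show ?thesis using large[OF 2] assms(7) by (simp add: field_simps)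
    next
      case 3
      then have "v (f x - f y) = inverse (v T)" using vf[of y] vD(6) by (simp add: f_def)
      then show ?thesis using large[OF 3(2,1)] vD(9)[of x y] assms(7) by (simp add: field_simps)
    next
      case 4
      then show ?thesis using vD(1) assms(7) v0 by (simp add: f_def)
    qed
  qed
  moreover have "f \<in> E \<rightarrow> E"
    using assms by (auto simp: f_def intro!: subfield_divide[OF E] subring_intros[OF Er])
  ultimately obtain \<rho> where \<rho>: "\<rho> \<in> E" "f \<rho> = \<rho>"
    using Banach_fixedpoint_thm[OF complete, of f "inverse (v T)"] subring_zero[OF Er] assms(7)
    by (metis empty_iff inverse_less_1_iff)
  \<comment> \<open>The default value 0 lies inside the ball, so the artificial branch of
    \<open>f\<close> has no fixed point of its own.\<close>
  have "v \<rho> \<le> 1"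
  proof (rule ccontr)
    assume "\<not> v \<rho> \<le> 1"
    then show False using \<rho>(2) v0 by (auto simp: f_def)
  qed
  then have "\<rho> * (T - \<rho>) = D"
    using \<rho>(2) nz[of \<rho>] by (auto simp: f_def field_simps)
  then show ?thesis using that \<rho> by blast
qed

text \<open>With a large trace the quadratic \<open>X^2 - T X + D\<close> would have a root
  \<open>\<rho>\<close> in \<open>E\<close>, hence also its second root \<open>T - \<rho>\<close>,
  and \<open>l\<close> would be one of the two.\<close>

lemma trace_integral_of_irreducible:
  fixes v :: "'c::field \<Rightarrow> real"
  assumes v: "nonarch_absolute_value v" and E: "subfield E ambient"
    and "Metric_space.mcomplete E (\<lambda>x y. v (x - y))"
    and T: "T \<in> E" and "D \<in> E" "v D = 1" and l: "l \<notin> E" "l * (T - l) = D"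
  shows "v T \<le> 1"
proof (rule ccontr)
  assume "\<not> v T \<le> 1"
  then obtain \<rho> where \<rho>: "\<rho> \<in> E" "\<rho> * (T - \<rho>) = D"
    using root_in_complete_field[OF assms(1-6)] by auto
  have "(l - \<rho>) * (l - (T - \<rho>)) = \<rho> * (T - \<rho>) - l * (T - l)" by (simp add: algebra_simps)
  then have "l = \<rho> \<or> l = T - \<rho>" using l \<rho> by simp
  then show False using l(1) \<rho>(1) T subring_diff[OF subfield_subring[OF E]] by auto
qed

subsection \<open>Finite fields\<close>

context
  fixes F :: "'c::field set"
  assumes F: "subfield F ambient" and fin: "finite F"
begin

private lemma Fr: "subring F ambient"
  by (rule subfield_subring[OF F])

lemma finite_subfield_card_ge_2: "card F \<ge> 2"
proof -
  have "card {0, 1::'c} \<le> card F"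
    using subring_zero[OF Fr] subring_one[OF Fr] fin by (intro card_mono) auto
  then show ?thesis by simp
qed

text \<open>Fermat's argument: multiplication by \<open>x\<close> permutes the nonzero elements, and
  comparing their products gives \<open>x ^ (q - 1) = 1\<close>.\<close>

lemma finite_subfield_pow_card: "x \<in> F \<Longrightarrow> x ^ card F = x"
proof (cases "x = 0")
  case True
  then show ?thesis using finite_subfield_card_ge_2 by (simp add: power_0_left)
next
  case False
  assume x: "x \<in> F"
  have bij: "bij_betw ((*) x) (F - {0}) (F - {0})"
  proof (rule bij_betwI[where g = "(*) (inverse x)"])
    show "(*) x \<in> F - {0} \<rightarrow> F - {0}" "(*) (inverse x) \<in> F - {0} \<rightarrow> F - {0}"
      using x False subfield_inverse[OF F x] by (auto intro: subring_mult[OF Fr])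
  qed (use False in \<open>auto simp: field_simps\<close>)
  have "(\<Prod>y\<in>F - {0}. y) = (\<Prod>y\<in>F - {0}. x * y)"
    using prod.reindex_bij_betw[OF bij, of "\<lambda>y. y"] by simp
  also have "\<dots> = x ^ card (F - {0}) * (\<Prod>y\<in>F - {0}. y)"
    by (simp add: prod.distrib)
  finally have "x ^ card (F - {0}) = 1"
    using fin by (simp add: prod_zero_iff)
  moreover have "card F = Suc (card (F - {0}))"
    using card_Suc_Diff1[OF fin subring_zero[OF Fr]] by simp
  ultimately show ?thesis by simp
qed

text \<open>\<open>X^q - X\<close> has at most \<open>q\<close> roots and \<open>F\<close> supplies
  \<open>q\<close> of them. Membership in \<open>F\<close> thereby becomes invariance under the
  Frobenius map.\<close>

lemma mem_finite_subfield_iff: "x \<in> F \<longleftrightarrow> x ^ card F = x"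
proof -
  define p :: "'c poly" where "p = Polynomial.monom 1 (card F) - Polynomial.monom 1 1"
  have c: "Polynomial.coeff p (card F) = 1" and le: "Polynomial.degree p \<le> card F"
    using finite_subfield_card_ge_2 by (auto simp: p_def degree_diff_le degree_monom_eq)
  then have p0: "p \<noteq> 0" by auto
  have roots: "{x. poly p x = 0} = {x. x ^ card F = x}"
    by (auto simp: p_def poly_monom)
  have "F = {x. poly p x = 0}"
  proof (rule card_seteq)
    show "finite {x. poly p x = 0}" using poly_roots_finite[OF p0] .
    show "F \<subseteq> {x. poly p x = 0}" using finite_subfield_pow_card by (auto simp: roots)
    show "card {x. poly p x = 0} \<le> card F" using card_poly_roots_bound[OF p0] le by simp
  qed
  then show ?thesis using roots by auto
qed

text \<open>
  The polynomial \<open>(X + 1)^q - X^q - 1\<close> has degree less than \<open>q\<close> and vanishes on the \<open>q\<close>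
  elements of \<open>F\<close>, so all its coefficients are zero.
\<close>

lemma finite_subfield_binomial_eq_0:
  assumes "0 < i" "i < card F"
  shows "(of_nat (card F choose i) :: 'c) = 0"
proof -
  define q where "q = card F"
  define p :: "'c poly" where "p = (\<Sum>i\<in>{0<..<q}. Polynomial.monom (of_nat (q choose i)) i)"
  have q: "q \<ge> 2" using finite_subfield_card_ge_2 by (simp add: q_def)
  have deg: "Polynomial.degree p < q"
  proof -
    have "Polynomial.degree p \<le> q - 1"
      unfolding p_def by (intro degree_sum_le) (auto intro: order.trans[OF degree_monom_le])
    then show ?thesis using q by simp
  qed
  have "poly p x = 0" if "x \<in> F" for x
  proof -
    have "(x + 1) ^ q = (\<Sum>i\<le>q. of_nat (q choose i) * x ^ i)"
      by (simp add: binomial_ring)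
    also have "{..q} = insert 0 (insert q {0<..<q})" using q by auto
    also have "(\<Sum>i\<in>\<dots>. of_nat (q choose i) * x ^ i) = 1 + (x ^ q + poly p x)"
      using q by (simp add: p_def poly_sum poly_monom)
    finally show ?thesis
      using finite_subfield_pow_card[OF that]
        finite_subfield_pow_card[OF subring_add[OF Fr that subring_one[OF Fr]]]
      by (simp add: q_def)
  qed
  then have "F \<subseteq> {x. poly p x = 0}" by auto
  have "p = 0"
  proof (rule ccontr)
    assume "p \<noteq> 0"
    then have "card F \<le> Polynomial.degree p"
      using card_mono[OF poly_roots_finite \<open>F \<subseteq> _\<close>] card_poly_roots_bound[of p] by fastforce
    then show False using deg by (simp add: q_def)
  qed
  moreover have "Polynomial.coeff p i = of_nat (q choose i)"
    using assms by (simp add: p_def coeff_sum q_def)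
  ultimately show ?thesis by (simp add: q_def)
qed

text \<open>The inner binomial coefficients vanish in the ambient field itself, so additivity is
  available outside \<open>F\<close>, in particular for elements of the quadratic extension.\<close>

lemma finite_subfield_frobenius_add: "(x + y :: 'c) ^ card F = x ^ card F + y ^ card F"
proof -
  define q where "q = card F"
  have q: "q \<ge> 2" using finite_subfield_card_ge_2 by (simp add: q_def)
  have "(x + y) ^ q = (\<Sum>i\<le>q. of_nat (q choose i) * x ^ i * y ^ (q - i))"
    by (simp add: binomial_ring)
  also have "{..q} = insert 0 (insert q {0<..<q})" using q by auto
  also have "(\<Sum>i\<in>\<dots>. of_nat (q choose i) * x ^ i * y ^ (q - i)) = y ^ q + (x ^ q + 0)"
    using q finite_subfield_binomial_eq_0 by (simp add: q_def)
  finally show ?thesis by (simp add: q_def add.commute)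
qed

lemma finite_subfield_frobenius_diff: "(x - y :: 'c) ^ card F = x ^ card F - y ^ card F"
  using finite_subfield_frobenius_add[of "x - y" y] by (simp add: algebra_simps)

lemma mem_quadratic_constants_iff: "x \<in> quadratic_constants F \<longleftrightarrow> (x ^ card F) ^ card F = x"
  by (simp add: quadratic_constants_def power2_eq_square power_mult)

text \<open>The Frobenius map interchanges \<open>x\<close> and \<open>x ^ card F\<close>, so it
  fixes their sum and product.\<close>

lemma quadratic_constants_trace_norm:
  assumes "x \<in> quadratic_constants F"
  shows "x + x ^ card F \<in> F" "x * x ^ card F \<in> F"
proof -
  have y: "(x ^ card F) ^ card F = x" using assms by (simp only: mem_quadratic_constants_iff)
  show "x + x ^ card F \<in> F"
    unfolding mem_finite_subfield_iff finite_subfield_frobenius_add y by (rule add.commute)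
  show "x * x ^ card F \<in> F"
    unfolding mem_finite_subfield_iff power_mult_distrib y by (rule mult.commute)
qed

text \<open>Since \<open>T\<close> and \<open>D\<close> are fixed by the Frobenius map, it sends
  \<open>x\<close> to \<open>x\<close> or to the other root \<open>T - x\<close>; in either case
  applying it twice returns \<open>x\<close>.\<close>

lemma root_mem_quadratic_constants:
  assumes "T \<in> F" "D \<in> F" "x * (T - x) = D"
  shows "x \<in> quadratic_constants F"
proof -
  define y where "y = x ^ card F"
  have "y * (T - y) = (x * (T - x)) ^ card F"
    using finite_subfield_pow_card[OF assms(1)]
    by (simp add: y_def finite_subfield_frobenius_diff power_mult_distrib)
  also have "\<dots> = x * (T - x)" using assms finite_subfield_pow_card by simp
  finally have "(y - x) * (y - (T - x)) = 0" by (simp add: algebra_simps)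
  then consider "y = x" | "y = T - x" by auto
  then show ?thesis
  proof cases
    case 1
    then show ?thesis by (simp add: mem_quadratic_constants_iff y_def)
  next
    case 2
    have "(x ^ card F) ^ card F = T - y"
      unfolding y_def[symmetric] unfolding 2 finite_subfield_frobenius_diff
      using finite_subfield_pow_card[OF assms(1)] 2 by (simp add: y_def)
    then show ?thesis unfolding mem_quadratic_constants_iff 2 by simp
  qed
qed

lemma quadratic_constants_span:
  assumes e: "e \<in> quadratic_constants F - F" and x: "x \<in> quadratic_constants F"
  obtains a b where "a \<in> F" "b \<in> F" "x = a + b * e"
proof -
  define q where "q = card F"
  have ne: "e - e ^ q \<noteq> 0" using e mem_finite_subfield_iff[of e] by (auto simp: q_def)
  have ee: "(e ^ q) ^ q = e" and xx: "(x ^ q) ^ q = x"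
    using e x by (auto simp: mem_quadratic_constants_iff q_def)
  \<comment> \<open>Obtained by subtracting \<open>x ^ q = a + b * e ^ q\<close> from the desired
    \<open>x = a + b * e\<close>; the quotient is Frobenius invariant because numerator and
    denominator both change sign.\<close>
  define b where "b = (x - x ^ q) / (e - e ^ q)"
  have "b ^ q = (x ^ q - x) / (e ^ q - e)"
    unfolding b_def power_divide
    unfolding q_def finite_subfield_frobenius_diff unfolding q_def[symmetric] ee xx ..
  also have "\<dots> = b"
    unfolding b_def by (metis minus_diff_eq minus_divide_divide)
  finally have bF: "b ^ q = b" .
  have "b * (e - e ^ q) = x - x ^ q" using ne by (simp add: b_def)
  then have "x ^ q - b * e ^ q = x - b * e" by (simp add: algebra_simps)
  then have "(x - b * e) ^ q = x - b * e"
    using bF by (simp add: q_def finite_subfield_frobenius_diff power_mult_distrib)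
  then have "x - b * e \<in> F" "b \<in> F" using bF by (simp_all add: mem_finite_subfield_iff q_def)
  then show ?thesis using that[of "x - b * e" b] by simp
qed

end

subsection \<open>The quadratic extension of the coordinate ring\<close>

text \<open>\<open>\<tau>\<close> and \<open>\<nu>\<close> are the trace and norm of
  \<open>\<epsilon>\<close>, so \<open>\<tau> - \<epsilon>\<close> is its conjugate. The last
  assumption says that the different is trivial; it is what lets \<open>t\<close> be recovered from
  the product of an elliptic ideal with its conjugate.\<close>

locale quadratic_extension =
  fixes K A At :: "'c::field set" and \<sigma> :: "'c \<Rightarrow> 'c" and \<epsilon> \<tau> \<nu> :: 'c
  assumes K: "subfield K ambient" and A: "subring A ambient" and AK: "A \<subseteq> K"
    and \<tau>: "\<tau> \<in> A" and \<nu>: "\<nu> \<in> A" and \<epsilon>_root: "\<epsilon> * (\<tau> - \<epsilon>) = \<nu>" and \<epsilon>_notin: "\<epsilon> \<notin> K"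
    and At_eq: "At = {a + b * \<epsilon> | a b. a \<in> A \<and> b \<in> A}"
    and \<sigma>_eq: "\<And>a b. a \<in> A \<Longrightarrow> b \<in> A \<Longrightarrow> \<sigma> (a + b * \<epsilon>) = a + b * (\<tau> - \<epsilon>)"
    and different_unit: "\<exists>w\<in>At. w * (\<epsilon> - (\<tau> - \<epsilon>)) = 1"
begin

lemma \<epsilon>_square: "\<epsilon> * \<epsilon> = \<tau> * \<epsilon> - \<nu>"
  using \<epsilon>_root by (simp add: algebra_simps)

lemma AtI: "a \<in> A \<Longrightarrow> b \<in> A \<Longrightarrow> a + b * \<epsilon> \<in> At"
  by (auto simp: At_eq)

lemma AtE:
  assumes "x \<in> At"
  obtains a b where "a \<in> A" "b \<in> A" "x = a + b * \<epsilon>"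
  using assms by (auto simp: At_eq)

lemma A_subset_At: "A \<subseteq> At"
  using AtI[of _ 0] subring_zero[OF A] by auto

lemma \<epsilon>_mem: "\<epsilon> \<in> At"
  using AtI[of 0 1] subring_zero[OF A] subring_one[OF A] by auto

lemma basis_zero:
  assumes "a \<in> K" "b \<in> K" "a + b * \<epsilon> = 0"
  shows "a = 0 \<and> b = 0"
proof -
  have "b = 0"
  proof (rule ccontr)
    assume "b \<noteq> 0"
    then have "\<epsilon> = - a / b" using assms(3) by (simp add: field_simps eq_neg_iff_add_eq_0)
    then show False
      using \<epsilon>_notin subfield_divide[OF K subring_uminus[OF subfield_subring[OF K]]] assms by metis
  qed
  then show ?thesis using assms(3) by simp
qed

lemma basis_unique:
  assumes "a \<in> K" "b \<in> K" "c \<in> K" "d \<in> K" "a + b * \<epsilon> = c + d * \<epsilon>"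
  shows "a = c \<and> b = d"
  using basis_zero[of "a - c" "b - d"] assms subring_diff[OF subfield_subring[OF K]]
  by (auto simp: algebra_simps)

lemma At_mult: "(a + b * \<epsilon>) * (c + d * \<epsilon>) = (a * c - b * d * \<nu>) + (a * d + b * c + b * d * \<tau>) * \<epsilon>"
proof -
  have "(a + b * \<epsilon>) * (c + d * \<epsilon>) = a * c + (a * d + b * c) * \<epsilon> + b * d * (\<epsilon> * \<epsilon>)"
    by (simp add: algebra_simps)
  then show ?thesis unfolding \<epsilon>_square by (simp add: algebra_simps)
qed

lemma At: "subring At ambient"
  unfolding subring_ambient_iff
proof (intro conjI ballI)
  show "1 \<in> At" using A_subset_At subring_one[OF A] by auto
  fix x y assume "x \<in> At" "y \<in> At"
  then obtain a b c d where *: "a \<in> A" "b \<in> A" "x = a + b * \<epsilon>" "c \<in> A" "d \<in> A" "y = c + d * \<epsilon>"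
    by (metis AtE)
  then have "(a - c) + (b - d) * \<epsilon> \<in> At"
    "(a * c - b * d * \<nu>) + (a * d + b * c + b * d * \<tau>) * \<epsilon> \<in> At"
    using \<tau> \<nu> by (auto intro!: AtI subring_intros[OF A])
  then show "x - y \<in> At" "x * y \<in> At"
    unfolding * At_mult by (simp_all add: algebra_simps)
qed

lemma At_Int_K: "x \<in> At \<Longrightarrow> x \<in> K \<Longrightarrow> x \<in> A"
  using basis_unique[of _ _ x 0] AK subring_zero[OF A] by (metis AtE add.right_neutral mult_zero_left subsetD)

lemma \<sigma>_A: "a \<in> A \<Longrightarrow> \<sigma> a = a"
  using \<sigma>_eq[of a 0] subring_zero[OF A] by simp

lemma \<sigma>_\<epsilon>: "\<sigma> \<epsilon> = \<tau> - \<epsilon>"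
  using \<sigma>_eq[of 0 1] subring_zero[OF A] subring_one[OF A] by simp

lemma conj_mem: "\<tau> - \<epsilon> \<in> At"
  using \<tau> A_subset_At \<epsilon>_mem subring_diff[OF At] by auto

lemma \<sigma>_mem: "x \<in> At \<Longrightarrow> \<sigma> x \<in> At"
proof -
  assume "x \<in> At"
  then obtain a b where "a \<in> A" "b \<in> A" "x = a + b * \<epsilon>" by (rule AtE)
  then show ?thesis
    using conj_mem A_subset_At by (simp add: \<sigma>_eq subring_add[OF At] subring_mult[OF At] subset_iff)
qed

lemma \<sigma>_mult:
  assumes "x \<in> At" "y \<in> At" shows "\<sigma> (x * y) = \<sigma> x * \<sigma> y"
proof -
  obtain a b c d where *: "a \<in> A" "b \<in> A" "x = a + b * \<epsilon>" "c \<in> A" "d \<in> A" "y = c + d * \<epsilon>"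
    using assms by (metis AtE)
  have "\<sigma> (x * y) = (a * c - b * d * \<nu>) + (a * d + b * c + b * d * \<tau>) * (\<tau> - \<epsilon>)"
    unfolding * At_mult using * \<tau> \<nu> by (intro \<sigma>_eq) (auto intro!: subring_intros[OF A])
  also have "\<dots> = a * c + (a * d + b * c) * (\<tau> - \<epsilon>) + b * d * (\<tau> * (\<tau> - \<epsilon>) - \<nu>)"
    by (simp add: algebra_simps)
  also have "\<tau> * (\<tau> - \<epsilon>) - \<nu> = (\<tau> - \<epsilon>) * (\<tau> - \<epsilon>)"
    using \<epsilon>_root by (simp add: algebra_simps)
  also have "a * c + (a * d + b * c) * (\<tau> - \<epsilon>) + b * d * ((\<tau> - \<epsilon>) * (\<tau> - \<epsilon>)) =
      (a + b * (\<tau> - \<epsilon>)) * (c + d * (\<tau> - \<epsilon>))"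
    by (simp add: algebra_simps)
  also have "\<dots> = \<sigma> x * \<sigma> y" using * by (simp add: \<sigma>_eq)
  finally show ?thesis .
qed

lemma norm_mem:
  assumes "x \<in> At" shows "x * \<sigma> x \<in> A"
proof -
  obtain a b where *: "a \<in> A" "b \<in> A" "x = a + b * \<epsilon>" using assms by (rule AtE)
  have "x * \<sigma> x = a * a + a * b * \<tau> + b * b * (\<epsilon> * (\<tau> - \<epsilon>))"
    unfolding *(3) \<sigma>_eq[OF *(1,2)] by (simp add: algebra_simps)
  then show ?thesis
    unfolding \<epsilon>_root using * \<tau> \<nu> by (auto intro!: subring_intros[OF A])
qed

lemma norm_nonzero:
  assumes "x \<in> At" "x \<noteq> 0" shows "x * \<sigma> x \<noteq> 0"
proof -
  obtain a b where *: "a \<in> A" "b \<in> A" "x = a + b * \<epsilon>" using assms(1) by (rule AtE)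
  have "\<sigma> x \<noteq> 0"
  proof
    assume "\<sigma> x = 0"
    then have "(a + b * \<tau>) + (- b) * \<epsilon> = 0"
      unfolding *(3) \<sigma>_eq[OF *(1,2)] by (simp add: algebra_simps)
    moreover have "a + b * \<tau> \<in> A" "- b \<in> A" using * \<tau> by (auto intro!: subring_intros[OF A])
    ultimately have "a + b * \<tau> = 0 \<and> - b = 0" using AK by (intro basis_zero) auto
    then show False using *(3) assms(2) by auto
  qed
  then show ?thesis using assms(2) by simp
qed

text \<open>
  Ideals with \<open>I \<sigma>(I)\<close> generated by an element of \<open>A\<close> have trivial norm class; passing to
  another representative multiplies that generator by a quotient of norms, which stays in \<open>A\<close>
  because \<open>At \<inter> K = A\<close>.
\<close>

lemma ideal_class_mem_kernel:
  assumes I: "ideal I (subring_of At)" "I \<noteq> {0}" and z: "z \<in> A - {0}"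
    and norm: "I \<cdot>\<^bsub>subring_of At\<^esub> \<sigma> ` I = (*) z ` At"
  shows "ideal_class At I \<in> kernel (class_group At) (class_group A) (class_norm A At \<sigma>)"
proof -
  have *: "ideal_class A ((J \<cdot>\<^bsub>subring_of At\<^esub> \<sigma> ` J) \<inter> A) = ideal_class A A"
    if J: "J \<in> ideal_class At I" for J
  proof -
    obtain x y where xy: "x \<in> At - {0}" "y \<in> At - {0}" "(*) x ` I = (*) y ` J"
      using J unfolding mem_ideal_class_iff by blast
    have JAt: "J \<subseteq> At" and IAt: "I \<subseteq> At" and Jmult: "\<And>r j. r \<in> At \<Longrightarrow> j \<in> J \<Longrightarrow> r * j \<in> J"
      using J I(1) by (auto simp: mem_ideal_class_iff ideal_subring_of_iff[OF At])
    have conj: "\<sigma> ` (*) u ` L = (*) (\<sigma> u) ` \<sigma> ` L" if "u \<in> At" "L \<subseteq> At" for u L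
      unfolding image_image using that by (intro image_cong refl \<sigma>_mult) auto
    define m n P where "m = x * \<sigma> x" and "n = y * \<sigma> y" and "P = J \<cdot>\<^bsub>subring_of At\<^esub> \<sigma> ` J"
    have mn: "m \<in> A - {0}" "n \<in> A - {0}"
      using xy norm_mem norm_nonzero by (auto simp: m_def n_def)
    have "(*) (\<sigma> x) ` \<sigma> ` I = (*) (\<sigma> y) ` \<sigma> ` J"
      using conj[OF _ IAt, of x] conj[OF _ JAt, of y] xy by simp
    then have scaled: "(*) m ` (*) z ` At = (*) n ` P"
      unfolding P_def norm[symmetric] m_def n_def ideal_prod_scale[symmetric] using xy(3) by simp
    have PAt: "P \<subseteq> At"
      unfolding P_def using JAt \<sigma>_mem
      by (intro ideal_prod_subsetI) (auto intro!: subring_intros[OF At])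
    \<comment> \<open>Testing the equality of the scaled ideals on the generator yields
      \<open>w = m * z / n\<close>, an element of \<open>P\<close> that lies in \<open>K\<close>,
      hence in \<open>A\<close>; it turns out to generate \<open>P \<inter> A\<close>.\<close>
    have "m * (z * 1) \<in> (*) n ` P"
      unfolding scaled[symmetric] using subring_one[OF At] by blast
    then obtain w where w: "w \<in> P" "m * z = n * w" by auto
    have "w = m * z / n" using w(2) mn by (simp add: field_simps)
    then have wA: "w \<in> A"
      using PAt w(1) mn z AK
      by (auto intro!: At_Int_K subfield_divide[OF K] subring_mult[OF subfield_subring[OF K]])
    have w0: "w \<noteq> 0" using w(2) mn z by auto
    have "P \<inter> A = (*) w ` A"
    proof
      show "P \<inter> A \<subseteq> (*) w ` A"
      proof
        fix r assume r: "r \<in> P \<inter> A"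
        then have "n * r \<in> (*) m ` (*) z ` At" unfolding scaled by blast
        then obtain a where a: "a \<in> At" "n * r = m * (z * a)" by auto
        then have "n * r = n * (w * a)" using w(2) by (simp add: mult.assoc[symmetric])
        then have "r = w * a" using mn by simp
        moreover from this have "a = r / w" using w0 by simp
        then have "a \<in> A"
          using a(1) r wA AK by (auto intro!: At_Int_K subfield_divide[OF K])
        ultimately show "r \<in> (*) w ` A" by blast
      qed
      have "a * w \<in> P" if "a \<in> A" for a
        unfolding P_def using ideal_prod_closed_mult[of At J a w] Jmult w(1) that A_subset_At
        by (auto simp: P_def)
      then show "(*) w ` A \<subseteq> P \<inter> A"
        using wA by (auto simp: mult.commute[of w] intro: subring_mult[OF A])
    qed
    then show ?thesis
      using ideal_class_principal[OF A, of w] wA w0 by (simp add: P_def)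
  qed
  have "class_norm A At \<sigma> (ideal_class At I) = (\<Union>J\<in>ideal_class At I. ideal_class A A)"
    unfolding class_norm_def using * by auto
  also have "\<dots> = \<one>\<^bsub>class_group A\<^esub>"
    using ideal_class_self[OF At I] by (auto simp: class_group_def)
  finally show ?thesis
    using I by (auto simp: kernel_def class_group_def)
qed

section \<open>Lattices \<open>A p1 + A p2\<close> and the ideals of elliptic elements\<close>

definition lattice :: "'c \<Rightarrow> 'c \<Rightarrow> 'c set"
  where "lattice p1 p2 = {x * p1 + y * p2 | x y. x \<in> A \<and> y \<in> A}"

lemma latticeI: "x \<in> A \<Longrightarrow> y \<in> A \<Longrightarrow> x * p1 + y * p2 \<in> lattice p1 p2"
  by (auto simp: lattice_def)

lemma lattice_add: "u \<in> lattice p1 p2 \<Longrightarrow> w \<in> lattice p1 p2 \<Longrightarrow> u + w \<in> lattice p1 p2"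
proof -
  assume "u \<in> lattice p1 p2" "w \<in> lattice p1 p2"
  then obtain x y x' y' where *: "x \<in> A" "y \<in> A" "x' \<in> A" "y' \<in> A"
    "u = x * p1 + y * p2" "w = x' * p1 + y' * p2" by (auto simp: lattice_def)
  have "(x + x') * p1 + (y + y') * p2 \<in> lattice p1 p2"
    using * by (intro latticeI subring_add[OF A])
  then show ?thesis using * by (simp add: algebra_simps)
qed

lemma lattice_smult: "a \<in> A \<Longrightarrow> u \<in> lattice p1 p2 \<Longrightarrow> a * u \<in> lattice p1 p2"
proof -
  assume a: "a \<in> A" and "u \<in> lattice p1 p2"
  then obtain x y where *: "x \<in> A" "y \<in> A" "u = x * p1 + y * p2" by (auto simp: lattice_def)
  have "(a * x) * p1 + (a * y) * p2 \<in> lattice p1 p2"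
    using * a by (intro latticeI subring_mult[OF A])
  then show ?thesis using * by (simp add: algebra_simps)
qed

lemma lattice_mem: "p1 \<in> lattice p1 p2" "p2 \<in> lattice p1 p2"
  using latticeI[of 1 0 p1 p2] latticeI[of 0 1 p1 p2] subring_zero[OF A] subring_one[OF A] by auto

lemma lattice_scale: "(*) u ` lattice p1 p2 = lattice (u * p1) (u * p2)"
proof -
  have "u * (x * p1 + y * p2) = x * (u * p1) + y * (u * p2)" for x y
    by (simp add: algebra_simps)
  then show ?thesis by (fastforce simp: lattice_def image_def)
qed

definition elliptic_form :: "'c \<Rightarrow> 'c \<Rightarrow> 'c \<Rightarrow> bool"
  where "elliptic_form \<omega> s t \<longleftrightarrow> s \<in> A \<and> t \<in> A - {0} \<and> \<omega> = (\<epsilon> + s) / t \<and>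
    (\<exists>k\<in>A. (\<sigma> \<epsilon> + s) * (\<epsilon> + s) = t * k)"

lemma elliptic_ideal_eq:
  assumes "elliptic_form \<omega> s t"
  shows "elliptic_ideal A \<sigma> \<epsilon> \<omega> = lattice (\<epsilon> + s) t"
  unfolding elliptic_ideal_def
proof (rule the_equality)
  show "\<exists>s'\<in>A. \<exists>t'\<in>A - {0}. \<omega> = (\<epsilon> + s') / t' \<and>
       t' divides\<^bsub>subring_of A\<^esub> ((\<sigma> \<epsilon> + s') * (\<epsilon> + s')) \<and>
       lattice (\<epsilon> + s) t = {x * (\<epsilon> + s') + y * t' | x y. x \<in> A \<and> y \<in> A}"
    using assms unfolding elliptic_form_def factor_def lattice_def
    by (intro bexI[of _ s] bexI[of _ t]) auto
  fix J
  assume "\<exists>s'\<in>A. \<exists>t'\<in>A - {0}. \<omega> = (\<epsilon> + s') / t' \<and>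
       t' divides\<^bsub>subring_of A\<^esub> ((\<sigma> \<epsilon> + s') * (\<epsilon> + s')) \<and>
       J = {x * (\<epsilon> + s') + y * t' | x y. x \<in> A \<and> y \<in> A}"
  then obtain s' t' where *: "s' \<in> A" "t' \<in> A - {0}" "\<omega> = (\<epsilon> + s') / t'"
    "J = lattice (\<epsilon> + s') t'" unfolding lattice_def by blast
  have st: "s \<in> A" "t \<in> A - {0}" "\<omega> = (\<epsilon> + s) / t" using assms by (auto simp: elliptic_form_def)
  then have "(\<epsilon> + s) / t = (\<epsilon> + s') / t'" using * by simp
  then have "s * t' + t' * \<epsilon> = s' * t + t * \<epsilon>" using *(2) st(2) by (simp add: field_simps)
  then have "s * t' = s' * t \<and> t' = t"
    using *(1,2) st AK by (intro basis_unique) (auto intro!: subring_mult[OF subfield_subring[OF K]])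
  then show "J = lattice (\<epsilon> + s) t" using * st by auto
qed

text \<open>The divisibility in \<open>elliptic_form\<close> serves twice: it makes the lattice
  stable under \<open>\<epsilon>\<close>, and it puts the product of \<open>\<epsilon> + s\<close>
  with its conjugate into the ideal of \<open>t\<close>. Conversely, the product ideal contains
  \<open>(\<epsilon> + s) * t\<close> and its conjugate, hence their difference, which is
  \<open>t\<close> times the unit \<open>\<epsilon> - (\<tau> - \<epsilon>)\<close>.\<close>

lemma
  assumes "elliptic_form \<omega> s t"
  shows elliptic_lattice_ideal: "ideal (lattice (\<epsilon> + s) t) (subring_of At)"
    and elliptic_lattice_nonzero: "lattice (\<epsilon> + s) t \<noteq> {0}"
    and elliptic_lattice_norm:
      "lattice (\<epsilon> + s) t \<cdot>\<^bsub>subring_of At\<^esub> \<sigma> ` lattice (\<epsilon> + s) t = (*) t ` At"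
proof -
  obtain k where st: "s \<in> A" "t \<in> A" "t \<noteq> 0" and k: "k \<in> A" "(\<tau> - \<epsilon> + s) * (\<epsilon> + s) = t * k"
    using assms by (auto simp: elliptic_form_def \<sigma>_\<epsilon>)
  define J where "J = lattice (\<epsilon> + s) t"
  have es: "\<epsilon> + s \<in> At" "\<tau> - \<epsilon> + s \<in> At"
    using st A_subset_At \<epsilon>_mem conj_mem by (auto intro!: subring_add[OF At])
  have JAt: "J \<subseteq> At"
    unfolding J_def lattice_def using es st A_subset_At by (auto intro!: subring_intros[OF At])
  have \<epsilon>J: "\<epsilon> * u \<in> J" if u: "u \<in> J" for u
  proof -
    obtain x y where xy: "x \<in> A" "y \<in> A" "u = x * (\<epsilon> + s) + y * t"
      using u by (auto simp: J_def lattice_def)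
    \<comment> \<open>Write \<open>\<epsilon> = (\<tau> + s) - (\<tau> - \<epsilon> + s)\<close>:
      the first term is in \<open>A\<close>, and the second times \<open>\<epsilon> + s\<close> is
      \<open>t * k\<close>.\<close>
    have e: "\<epsilon> * (\<epsilon> + s) = (\<tau> + s) * (\<epsilon> + s) - t * k"
      using k(2) by (simp add: algebra_simps)
    have "\<epsilon> * u = x * (\<epsilon> * (\<epsilon> + s)) + y * \<epsilon> * t"
      unfolding xy by (simp add: algebra_simps)
    then have "\<epsilon> * u = (x * (\<tau> + s) + y * t) * (\<epsilon> + s) + (- (x * k) - y * s) * t"
      unfolding e by (simp add: algebra_simps)
    then show ?thesis
      unfolding J_def using xy st \<tau> k by (simp only:) (intro latticeI subring_intros[OF A]; assumption)
  qed
  have Jid: "ideal J (subring_of At)"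
    unfolding ideal_subring_of_iff[OF At]
  proof (intro conjI ballI)
    show "0 \<in> J" using latticeI[of 0 0] subring_zero[OF A] by (simp add: J_def)
    fix u assume u: "u \<in> J"
    show "u + w \<in> J" if "w \<in> J" for w using u that lattice_add by (simp add: J_def)
    fix r assume "r \<in> At"
    then obtain a b where r: "a \<in> A" "b \<in> A" "r = a + b * \<epsilon>" by (rule AtE)
    then have "a * u + b * (\<epsilon> * u) \<in> J"
      using u \<epsilon>J[OF u] lattice_add lattice_smult by (simp add: J_def)
    then show "r * u \<in> J" unfolding r by (simp add: algebra_simps)
  qed (rule JAt)
  then show "ideal (lattice (\<epsilon> + s) t) (subring_of At)" by (simp add: J_def)
  show "lattice (\<epsilon> + s) t \<noteq> {0}" using lattice_mem(2)[of t "\<epsilon> + s"] st by auto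
  have \<sigma>J: "\<sigma> u \<in> lattice (\<tau> - \<epsilon> + s) t" if u: "u \<in> J" for u
  proof -
    obtain x y where xy: "x \<in> A" "y \<in> A" "u = x * (\<epsilon> + s) + y * t"
      using u by (auto simp: J_def lattice_def)
    have "u = (x * s + y * t) + x * \<epsilon>" unfolding xy by (simp add: algebra_simps)
    then have "\<sigma> u = (x * s + y * t) + x * (\<tau> - \<epsilon>)"
      using xy st by (simp only:) (intro \<sigma>_eq subring_intros[OF A]; assumption)
    then have "\<sigma> u = x * (\<tau> - \<epsilon> + s) + y * t" by (simp add: algebra_simps)
    then show ?thesis using xy by (simp add: latticeI)
  qed
  have "J \<cdot>\<^bsub>subring_of At\<^esub> \<sigma> ` J \<subseteq> (*) t ` At"
  proof (rule ideal_prod_subsetI)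
    fix i j assume "i \<in> J" "j \<in> \<sigma> ` J"
    then obtain x y x' y' where *: "x \<in> A" "y \<in> A" "i = x * (\<epsilon> + s) + y * t"
      "x' \<in> A" "y' \<in> A" "j = x' * (\<tau> - \<epsilon> + s) + y' * t"
      using \<sigma>J unfolding J_def lattice_def by blast
    have "i * j = x * x' * ((\<tau> - \<epsilon> + s) * (\<epsilon> + s)) +
        t * (x * y' * (\<epsilon> + s) + y * x' * (\<tau> - \<epsilon> + s) + y * y' * t)"
      unfolding * by (simp add: algebra_simps)
    also have "\<dots> = t * (x * x' * k + (x * y' * (\<epsilon> + s) + y * x' * (\<tau> - \<epsilon> + s) + y * y' * t))"
      unfolding k(2) by (simp add: algebra_simps)
    finally show "i * j \<in> (*) t ` At"
      using * k(1) st es A_subset_At by (auto intro!: image_eqI subring_add[OF At] subring_mult[OF At])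
  next
    fix i j assume "i \<in> (*) t ` At" "j \<in> (*) t ` At"
    then show "i + j \<in> (*) t ` At" using subring_add[OF At] by (auto simp: distrib_left[symmetric])
  qed
  moreover have "(*) t ` At \<subseteq> J \<cdot>\<^bsub>subring_of At\<^esub> \<sigma> ` J"
  proof -
    define P where "P = J \<cdot>\<^bsub>subring_of At\<^esub> \<sigma> ` J"
    have Pm: "r * z \<in> P" if "r \<in> At" "z \<in> P" for r z
      using ideal_prod_closed_mult[of At J r z] Jid that
      by (simp add: P_def ideal_subring_of_iff[OF At])
    have tJ: "t \<in> J" and eJ: "\<epsilon> + s \<in> J" by (auto simp: J_def lattice_mem)
    have "\<sigma> t = t" using st by (simp add: \<sigma>_A)
    then have t\<sigma>: "t \<in> \<sigma> ` J" using tJ by (metis image_eqI)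
    have "\<sigma> (\<epsilon> + s) = \<tau> - \<epsilon> + s"
      using \<sigma>_eq[of s 1] st subring_one[OF A] by (simp add: add.commute)
    then have e\<sigma>: "\<tau> - \<epsilon> + s \<in> \<sigma> ` J" using eJ by (metis image_eqI)
    have "(\<epsilon> + s) * t \<in> P" "t * (\<tau> - \<epsilon> + s) \<in> P"
      unfolding P_def by (intro ideal_prod_mult eJ tJ t\<sigma> e\<sigma>)+
    then have "(\<epsilon> + s) * t + (- 1) * (t * (\<tau> - \<epsilon> + s)) \<in> P"
      using Pm[of "- 1"] subring_uminus[OF At subring_one[OF At]] ideal_prod_add
      unfolding P_def by blast
    then have d: "t * (\<epsilon> - (\<tau> - \<epsilon>)) \<in> P" by (simp add: algebra_simps)
    obtain w where w: "w \<in> At" "w * (\<epsilon> - (\<tau> - \<epsilon>)) = 1" using different_unit by blast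
    have "w * (t * (\<epsilon> - (\<tau> - \<epsilon>))) = t" using w(2) by (metis mult.left_commute mult_1_right)
    then have "t \<in> P" using Pm[OF w(1) d] by (simp only:)
    then have "t * r \<in> P" if "r \<in> At" for r using Pm[OF that] by (metis mult.commute)
    then show ?thesis by (auto simp: P_def)
  qed
  ultimately show "lattice (\<epsilon> + s) t \<cdot>\<^bsub>subring_of At\<^esub> \<sigma> ` lattice (\<epsilon> + s) t = (*) t ` At"
    by (simp add: J_def)
qed

end

subsection \<open>Matrices and Moebius transformations\<close>

lemma carrier_GL2_iff:
  "g \<in> carrier (GL2 R) \<longleftrightarrow> (\<forall>i j. g $ i $ j \<in> R) \<and>
     (\<exists>h. (\<forall>i j. h $ i $ j \<in> R) \<and> h ** g = mat 1 \<and> g ** h = mat 1)"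
  by (auto simp: GL2_def units_of_def Units_def matrices2_def)

lemma det_mem_subring:
  fixes g :: "'c::field^2^2"
  assumes "subring R ambient" "\<forall>i j. g $ i $ j \<in> R"
  shows "det g \<in> R"
  unfolding det_2 using assms(2) by (auto intro!: subring_intros[OF assms(1)])

lemma moebius_denominator_nonzero:
  fixes g :: "'c::field^2^2"
  assumes E: "subfield E ambient" and g: "\<forall>i j. g $ i $ j \<in> E" "det g \<noteq> 0" and w: "\<omega> \<notin> E"
  shows "g $ 2 $ 1 * \<omega> + g $ 2 $ 2 \<noteq> 0"
proof
  assume *: "g $ 2 $ 1 * \<omega> + g $ 2 $ 2 = 0"
  have "g $ 2 $ 1 = 0"
  proof (rule ccontr)
    assume "g $ 2 $ 1 \<noteq> 0"
    then have "\<omega> = - (g $ 2 $ 2) / g $ 2 $ 1"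
      using * by (simp add: field_simps eq_neg_iff_add_eq_0)
    then show False
      using w g(1) subfield_divide[OF E subring_uminus[OF subfield_subring[OF E]]] by metis
  qed
  then show False using * g(2) by (simp add: det_2)
qed

lemma moebius_action_mult:
  fixes g h :: "'c::field^2^2"
  assumes "subfield E ambient" "\<forall>i j. h $ i $ j \<in> E" "det h \<noteq> 0" "\<omega> \<notin> E"
  shows "moebius_action (g ** h) \<omega> = moebius_action g (moebius_action h \<omega>)"
proof -
  define p r where "p = h $ 1 $ 1 * \<omega> + h $ 1 $ 2" and "r = h $ 2 $ 1 * \<omega> + h $ 2 $ 2"
  have r: "r \<noteq> 0" using moebius_denominator_nonzero[OF assms] by (simp add: r_def)
  have "moebius_action (g ** h) \<omega> = (g $ 1 $ 1 * p + g $ 1 $ 2 * r) / (g $ 2 $ 1 * p + g $ 2 $ 2 * r)"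
    by (simp add: moebius_action_def matrix_matrix_mult_def sum_2 p_def r_def algebra_simps)
  also have "\<dots> = ((g $ 1 $ 1 * (p / r) + g $ 1 $ 2) * r) / ((g $ 2 $ 1 * (p / r) + g $ 2 $ 2) * r)"
    using r by (simp add: distrib_right)
  also have "\<dots> = moebius_action g (moebius_action h \<omega>)"
    using r by (simp add: moebius_action_def p_def[symmetric] r_def[symmetric])
  finally show ?thesis .
qed

lemma moebius_action_one: "moebius_action (mat 1) \<omega> = \<omega>"
  by (simp add: moebius_action_def mat_def)

text \<open>Unpacks the normalizer, a stabilizer of a subset under conjugation, into matrix terms;
  the inverse in the group record is identified with a two-sided matrix inverse
  \<open>N\<close>.\<close>

lemma normalizer_GL2_conj:
  fixes M :: "'c::field^2^2"
  assumes "A \<subseteq> K" and "M \<in> normalizer (GL2 K) (carrier (GL2 A))"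
  obtains N :: "'c^2^2" where "\<forall>i j. M $ i $ j \<in> K" "\<forall>i j. N $ i $ j \<in> K" "N ** M = mat 1" "M ** N = mat 1"
    "\<And>g. g \<in> carrier (GL2 A) \<Longrightarrow> M ** g ** N \<in> carrier (GL2 A)"
proof -
  have mult: "x \<otimes>\<^bsub>GL2 K\<^esub> y = x ** y" for x y by (simp add: GL2_def units_of_def matrices2_def)
  have one: "\<one>\<^bsub>GL2 K\<^esub> = mat 1" by (simp add: GL2_def units_of_def matrices2_def)
  have sub: "carrier (GL2 A) \<subseteq> carrier (GL2 K)"
    using assms(1) unfolding carrier_GL2_iff subset_iff by blast
  have M: "M \<in> carrier (GL2 K)"
    and norm: "M <#\<^bsub>GL2 K\<^esub> carrier (GL2 A) #>\<^bsub>GL2 K\<^esub> inv\<^bsub>GL2 K\<^esub> M = carrier (GL2 A)"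
    using assms(2) sub by (auto simp: normalizer_def stabilizer_def)
  obtain N :: "'c^2^2" where N: "\<forall>i j. N $ i $ j \<in> K" "N ** M = mat 1" "M ** N = mat 1"
    and MK: "\<forall>i j. M $ i $ j \<in> K"
    using M unfolding carrier_GL2_iff by blast
  have "N \<in> carrier (GL2 K)" unfolding carrier_GL2_iff using N MK by blast
  have "inv\<^bsub>GL2 K\<^esub> M = N"
    unfolding m_inv_def mult one
  proof (rule the_equality)
    show "N \<in> carrier (GL2 K) \<and> M ** N = mat 1 \<and> N ** M = mat 1" using \<open>N \<in> _\<close> N by blast
    fix N' assume "N' \<in> carrier (GL2 K) \<and> M ** N' = mat 1 \<and> N' ** M = mat 1"
    then show "N' = N" using N by (metis matrix_mul_assoc matrix_mul_lid matrix_mul_rid)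
  qed
  then have "M ** g ** N \<in> carrier (GL2 A)" if "g \<in> carrier (GL2 A)" for g
    using norm that unfolding l_coset_def r_coset_def mult by blast
  then show ?thesis using that N MK by blast
qed

text \<open>
  Conjugating the two elementary transvections shows that \<open>M E N\<close> is integral for every matrix
  unit \<open>E\<close>; as \<open>N\<close> is the adjugate of \<open>M\<close> divided by \<open>det M\<close>, this is the divisibility claim.
\<close>

lemma det_dvd_entry_products:
  fixes M N :: "'c::field^2^2"
  assumes A: "subring A ambient" and inv: "N ** M = mat 1" "M ** N = mat 1"
    and conj: "\<And>g. g \<in> carrier (GL2 A) \<Longrightarrow> M ** g ** N \<in> carrier (GL2 A)"
  shows "M $ i $ j * M $ k $ l / det M \<in> A"
proof -
  have eq_iff: "(g::'c^2^2) = h \<longleftrightarrow> g $ 1 $ 1 = h $ 1 $ 1 \<and> g $ 1 $ 2 = h $ 1 $ 2 \<and>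
      g $ 2 $ 1 = h $ 2 $ 1 \<and> g $ 2 $ 2 = h $ 2 $ 2" for g h
    by (auto simp: vec_eq_iff forall_2)
  have mult_nth: "(g ** h) $ i $ j = g $ i $ 1 * h $ 1 $ j + g $ i $ 2 * h $ 2 $ j"
    for g h :: "'c^2^2" and i j
    by (simp add: matrix_matrix_mult_def sum_2)
  have mat_nth: "(mat 1 :: 'c^2^2) $ i $ j = (if i = j then 1 else 0)" for i j
    by (simp add: mat_def)
  define U L :: "'c \<Rightarrow> 'c^2^2"
    where "U x = vector [vector [1, x], vector [0, 1]]"
      and "L x = vector [vector [1, 0], vector [x, 1]]" for x
  have "U 1 \<in> carrier (GL2 A)"
    unfolding carrier_GL2_iff using subring_one[OF A] subring_zero[OF A] subring_uminus[OF A]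
    by (intro conjI exI[of _ "U (- 1)"])
      (auto simp: forall_2 eq_iff mult_nth mat_nth U_def)
  then have conjU: "M ** U 1 ** N \<in> carrier (GL2 A)" by (rule conj)
  have "L 1 \<in> carrier (GL2 A)"
    unfolding carrier_GL2_iff using subring_one[OF A] subring_zero[OF A] subring_uminus[OF A]
    by (intro conjI exI[of _ "L (- 1)"])
      (auto simp: forall_2 eq_iff mult_nth mat_nth L_def)
  then have conjL: "M ** L 1 ** N \<in> carrier (GL2 A)" by (rule conj)
  have MN: "M $ i $ 1 * N $ 1 $ j + M $ i $ 2 * N $ 2 $ j = (if i = j then 1 else 0)"
    and NM: "N $ i $ 1 * M $ 1 $ j + N $ i $ 2 * M $ 2 $ j = (if i = j then 1 else 0)" for i j
    using inv mult_nth mat_nth by metis+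
  have e12: "M $ i $ 1 * N $ 2 $ j \<in> A" for i j
  proof -
    have "(M ** U 1 ** N) $ i $ j = (M $ i $ 1 * N $ 1 $ j + M $ i $ 2 * N $ 2 $ j) + M $ i $ 1 * N $ 2 $ j"
      by (simp add: mult_nth U_def algebra_simps)
    then have "M $ i $ 1 * N $ 2 $ j = (M ** U 1 ** N) $ i $ j - (if i = j then 1 else 0)"
      unfolding MN by simp
    moreover have "(M ** U 1 ** N) $ i $ j \<in> A" using conjU by (simp add: carrier_GL2_iff)
    ultimately show ?thesis
      using subring_diff[OF A] subring_one[OF A] subring_zero[OF A] by simp
  qed
  have e21: "M $ i $ 2 * N $ 1 $ j \<in> A" for i j
  proof -
    have "(M ** L 1 ** N) $ i $ j = (M $ i $ 1 * N $ 1 $ j + M $ i $ 2 * N $ 2 $ j) + M $ i $ 2 * N $ 1 $ j"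
      by (simp add: mult_nth L_def algebra_simps)
    then have "M $ i $ 2 * N $ 1 $ j = (M ** L 1 ** N) $ i $ j - (if i = j then 1 else 0)"
      unfolding MN by simp
    moreover have "(M ** L 1 ** N) $ i $ j \<in> A" using conjL by (simp add: carrier_GL2_iff)
    ultimately show ?thesis
      using subring_diff[OF A] subring_one[OF A] subring_zero[OF A] by simp
  qed
  \<comment> \<open>Transvections reach only the off-diagonal matrix units. The diagonal ones are
    their products, and inserting \<open>N ** M = mat 1\<close> in the middle gives
    \<open>M E11 N = (M E12 N) (M E21 N)\<close>.\<close>
  have e11: "M $ i $ 1 * N $ 1 $ j \<in> A" for i j
  proof -
    have "M $ i $ 1 * N $ 1 $ j = M $ i $ 1 * (N $ 2 $ 1 * M $ 1 $ 2 + N $ 2 $ 2 * M $ 2 $ 2) * N $ 1 $ j"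
      unfolding NM by simp
    also have "\<dots> = (M $ i $ 1 * N $ 2 $ 1) * (M $ 1 $ 2 * N $ 1 $ j) +
        (M $ i $ 1 * N $ 2 $ 2) * (M $ 2 $ 2 * N $ 1 $ j)"
      by (simp add: algebra_simps)
    finally show ?thesis using subring_add[OF A] subring_mult[OF A] e12 e21 by simp
  qed
  have e22: "M $ i $ 2 * N $ 2 $ j \<in> A" for i j
  proof -
    have "M $ i $ 2 * N $ 2 $ j = M $ i $ 2 * (N $ 1 $ 1 * M $ 1 $ 1 + N $ 1 $ 2 * M $ 2 $ 1) * N $ 2 $ j"
      unfolding NM by simp
    also have "\<dots> = (M $ i $ 2 * N $ 1 $ 1) * (M $ 1 $ 1 * N $ 2 $ j) +
        (M $ i $ 2 * N $ 1 $ 2) * (M $ 2 $ 1 * N $ 2 $ j)"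
      by (simp add: algebra_simps)
    finally show ?thesis using subring_add[OF A] subring_mult[OF A] e12 e21 by simp
  qed
  have all: "M $ i $ j * N $ k $ l \<in> A" for i j k l
    using e11 e12 e21 e22 exhaust_2[of j] exhaust_2[of k] by metis
  have "det M * det N = 1" using inv(2) det_mul[of M N] by (simp add: det_I)
  then have D: "det M \<noteq> 0" by auto
  have "det M * N $ 1 $ 1 = M $ 2 $ 2 * (M $ 1 $ 1 * N $ 1 $ 1 + M $ 1 $ 2 * N $ 2 $ 1) -
      M $ 1 $ 2 * (M $ 2 $ 1 * N $ 1 $ 1 + M $ 2 $ 2 * N $ 2 $ 1)"
    by (simp add: det_2 algebra_simps)
  then have n11: "M $ 2 $ 2 / det M = N $ 1 $ 1" unfolding MN using D by (simp add: field_simps)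
  have "det M * N $ 1 $ 2 = M $ 2 $ 2 * (M $ 1 $ 1 * N $ 1 $ 2 + M $ 1 $ 2 * N $ 2 $ 2) -
      M $ 1 $ 2 * (M $ 2 $ 1 * N $ 1 $ 2 + M $ 2 $ 2 * N $ 2 $ 2)"
    by (simp add: det_2 algebra_simps)
  then have n12: "M $ 1 $ 2 / det M = - N $ 1 $ 2" unfolding MN using D by (simp add: field_simps)
  have "det M * N $ 2 $ 1 = M $ 1 $ 1 * (M $ 2 $ 1 * N $ 1 $ 1 + M $ 2 $ 2 * N $ 2 $ 1) -
      M $ 2 $ 1 * (M $ 1 $ 1 * N $ 1 $ 1 + M $ 1 $ 2 * N $ 2 $ 1)"
    by (simp add: det_2 algebra_simps)
  then have n21: "M $ 2 $ 1 / det M = - N $ 2 $ 1" unfolding MN using D by (simp add: field_simps)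
  have "det M * N $ 2 $ 2 = M $ 1 $ 1 * (M $ 2 $ 1 * N $ 1 $ 2 + M $ 2 $ 2 * N $ 2 $ 2) -
      M $ 2 $ 1 * (M $ 1 $ 1 * N $ 1 $ 2 + M $ 1 $ 2 * N $ 2 $ 2)"
    by (simp add: det_2 algebra_simps)
  then have n22: "M $ 1 $ 1 / det M = N $ 2 $ 2" unfolding MN using D by (simp add: field_simps)
  have "\<exists>k' l'. M $ k $ l / det M = N $ k' $ l' \<or> M $ k $ l / det M = - N $ k' $ l'"
    using n11 n12 n21 n22 exhaust_2[of k] exhaust_2[of l] by metis
  then obtain k' l' where "M $ k $ l / det M = N $ k' $ l' \<or> M $ k $ l / det M = - N $ k' $ l'"
    by blast
  then have "M $ i $ j * (M $ k $ l / det M) \<in> A"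
    using all[of i j k' l'] subring_uminus[OF A, of "M $ i $ j * N $ k' $ l'"]
    by (metis mult_minus_right)
  then show ?thesis by simp
qed

text \<open>If \<open>g\<close> fixes \<open>\<omega>\<close>, its conjugate
  \<open>M ** g ** N\<close> fixes the image of \<open>\<omega>\<close>, and it is not scalar
  because conjugating a scalar matrix back changes nothing.\<close>

lemma elliptic_moebius_action:
  fixes M N :: "'c::field^2^2"
  assumes E: "subfield E ambient" and M: "\<forall>i j. M $ i $ j \<in> E" and N: "\<forall>i j. N $ i $ j \<in> E"
    and AE: "A \<subseteq> E"
    and inv: "N ** M = mat 1" "M ** N = mat 1"
    and conj: "\<And>g. g \<in> carrier (GL2 A) \<Longrightarrow> M ** g ** N \<in> carrier (GL2 A)"
    and ell: "elliptic A E \<omega>"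
  shows "elliptic A E (moebius_action M \<omega>)"
proof -
  obtain g where g: "g \<in> carrier (GL2 A)" "\<nexists>k. g = mat k" "moebius_action g \<omega> = \<omega>"
    and w: "\<omega> \<notin> E" using ell by (auto simp: elliptic_def)
  have det: "det M \<noteq> 0" "det N \<noteq> 0"
    using inv det_mul[of M N] det_I by (metis mult_zero_left mult_zero_right zero_neq_one)+
  obtain h where "g ** h = mat 1" using g(1) by (auto simp: carrier_GL2_iff)
  then have dg: "det g \<noteq> 0" using det_mul[of g h] det_I by (metis mult_zero_left zero_neq_one)
  have gE: "\<forall>i j. g $ i $ j \<in> E" using g(1) AE by (auto simp: carrier_GL2_iff)
  have undo: "moebius_action N (moebius_action M \<omega>) = \<omega>"
    using moebius_action_mult[OF E M det(1) w, of N] inv moebius_action_one by metis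
  have wM: "moebius_action M \<omega> \<notin> E"
  proof
    assume "moebius_action M \<omega> \<in> E"
    then have "moebius_action N (moebius_action M \<omega>) \<in> E"
      unfolding moebius_action_def[of N] using N
      by (auto intro!: subfield_divide[OF E] subring_intros[OF subfield_subring[OF E]])
    then show False using undo w by simp
  qed
  have "moebius_action (M ** g ** N) (moebius_action M \<omega>) = moebius_action M \<omega>"
    using moebius_action_mult[OF E N det(2) wM, of "M ** g"] moebius_action_mult[OF E gE dg w, of M]
      undo g(3) by simp
  moreover have "M ** g ** N \<noteq> mat k" for k
  proof
    assume "M ** g ** N = mat k"
    then have "N ** (M ** g ** N) ** M = N ** mat k ** M" by simp
    moreover have "N ** (M ** g ** N) ** M = (N ** M) ** g ** (N ** M)"
      by (simp add: matrix_mul_assoc)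
    moreover have "N ** mat k ** M = mat k ** (N ** M)"
      by (simp add: vec_eq_iff matrix_matrix_mult_def mat_def sum_2 forall_2 algebra_simps)
    ultimately have "g = mat k" using inv by simp
    then show False using g(2) by blast
  qed
  ultimately show ?thesis
    unfolding elliptic_def using wM conj[OF g(1)] by blast
qed

section \<open>Normal form of elliptic elements\<close>

context quadratic_extension
begin

lemma elliptic_form_exists:
  fixes v :: "'c \<Rightarrow> real"
  assumes F: "subfield F ambient" and fin: "finite F" and FA: "F \<subseteq> A"
    and \<epsilon>Q: "\<epsilon> \<in> quadratic_constants F - F"
    and E: "subfield E ambient" and KE: "K \<subseteq> E" and v: "nonarch_absolute_value v"
    and complete: "Metric_space.mcomplete E (\<lambda>x y. v (x - y))"
    and const: "\<And>x. x \<in> A \<Longrightarrow> v x \<le> 1 \<Longrightarrow> x \<in> F"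
    and units: "\<And>x y. x \<in> A \<Longrightarrow> y \<in> A \<Longrightarrow> x * y = 1 \<Longrightarrow> v x = 1"
    and ell: "elliptic A E \<omega>"
  obtains s t where "elliptic_form \<omega> s t"
proof -
  note Er = subfield_subring[OF E]
  obtain g where g: "g \<in> carrier (GL2 A)" "\<nexists>k. g = mat k" "moebius_action g \<omega> = \<omega>"
    and w: "\<omega> \<notin> E" using ell by (auto simp: elliptic_def)
  define a b c d where "a = g $ 1 $ 1" and "b = g $ 1 $ 2" and "c = g $ 2 $ 1" and "d = g $ 2 $ 2"
  have abcd: "a \<in> A" "b \<in> A" "c \<in> A" "d \<in> A"
    using g(1) by (auto simp: carrier_GL2_iff a_def b_def c_def d_def)
  have AE: "A \<subseteq> E" using AK KE by simp
  obtain h :: "'c^2^2" where h: "\<forall>i j. h $ i $ j \<in> A" "g ** h = mat 1" using g(1) by (auto simp: carrier_GL2_iff)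
  have gA: "\<forall>i j. g $ i $ j \<in> A" using g(1) by (auto simp: carrier_GL2_iff)
  define T D where "T = a + d" and "D = a * d - b * c"
  have D: "D = det g" by (simp add: D_def det_2 a_def b_def c_def d_def)
  have TD: "T \<in> A" "D \<in> A" using abcd by (auto simp: T_def D_def intro!: subring_intros[OF A])
  have Dh: "D * det h = 1" using h(2) det_mul[of g h] by (simp add: D det_I)
  then have vD: "v D = 1" using units[OF TD(2) det_mem_subring[OF A h(1)]] by simp
  have "c * \<omega> + d \<noteq> 0"
  proof -
    have "det g \<noteq> 0" using Dh D by auto
    moreover have "\<forall>i j. g $ i $ j \<in> E" using gA AE by blast
    ultimately show ?thesis
      using moebius_denominator_nonzero[OF E _ _ w, of g] by (simp add: c_def d_def)
  qed
  then have fix_eq: "a * \<omega> + b = \<omega> * (c * \<omega> + d)"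
    using g(3) by (simp add: moebius_action_def a_def b_def c_def d_def field_simps)
  have c0: "c \<noteq> 0"
  proof
    assume c: "c = 0"
    then have *: "(a - d) * \<omega> = - b" using fix_eq by (simp add: algebra_simps)
    have ad: "a = d"
    proof (rule ccontr)
      assume "a \<noteq> d"
      then have "\<omega> = - b / (a - d)" using * by (simp add: field_simps)
      then show False
        using w abcd AE by (auto intro!: subfield_divide[OF E] subring_intros[OF Er])
    qed
    then have "b = 0" using * by simp
    then have "g = mat a"
      using c ad by (simp add: vec_eq_iff forall_2 mat_def a_def b_def c_def d_def)
    then show False using g(2) by blast
  qed
  \<comment> \<open>The eigenvalue of \<open>g\<close> for the eigenvector with coordinates
    \<open>\<omega>\<close> and 1; the other eigenvalue is \<open>T - l\<close>.\<close>
  define l where "l = c * \<omega> + d"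
  have \<omega>: "\<omega> = (l - d) / c" using c0 by (simp add: l_def)
  have lE: "l \<notin> E"
    using w abcd AE unfolding \<omega> by (auto intro!: subfield_divide[OF E] subring_intros[OF Er])
  have lT: "l * (T - l) = D"
  proof -
    have "l * (T - l) = a * d + c * (a * \<omega> - \<omega> * (c * \<omega> + d))"
      by (simp add: l_def T_def algebra_simps)
    also have "a * \<omega> - \<omega> * (c * \<omega> + d) = - b" using fix_eq by (simp add: algebra_simps)
    finally show ?thesis by (simp add: D_def algebra_simps)
  qed
  have "v T \<le> 1"
    using trace_integral_of_irreducible[OF v E complete _ _ vD lE lT] TD AE by blast
  then have TDF: "T \<in> F" "D \<in> F" using const TD vD by auto
  have "l \<in> quadratic_constants F"
    by (rule root_mem_quadratic_constants[OF F fin TDF lT])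
  then obtain \<beta> \<alpha> where ba: "\<beta> \<in> F" "\<alpha> \<in> F" "l = \<beta> + \<alpha> * \<epsilon>"
    using quadratic_constants_span[OF F fin \<epsilon>Q] by metis
  have \<alpha>0: "\<alpha> \<noteq> 0" using lE ba FA AE by auto
  define i where "i = inverse \<alpha>"
  have i: "i \<in> A" "i * \<alpha> = 1" using subfield_inverse[OF F ba(2)] FA \<alpha>0 by (auto simp: i_def)
  have baA: "\<beta> \<in> A" "\<alpha> \<in> A" using ba FA by auto
  \<comment> \<open>The second eigenvalue is recognized as the conjugate of \<open>l\<close> by
    comparing coefficients of \<open>\<epsilon>\<close> in \<open>l * l = T * l - D\<close> and
    cancelling \<open>\<alpha>\<close>.\<close>
  have trace: "T - l = \<beta> + \<alpha> * (\<tau> - \<epsilon>)"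
  proof -
    have "l * l = T * l - D" using lT by (simp add: algebra_simps)
    then have "(\<beta> * \<beta> - \<alpha> * \<alpha> * \<nu>) + (\<beta> * \<alpha> + \<alpha> * \<beta> + \<alpha> * \<alpha> * \<tau>) * \<epsilon> = (T * \<beta> - D) + (T * \<alpha>) * \<epsilon>"
      unfolding ba(3) At_mult by (simp add: algebra_simps)
    moreover have "\<beta> * \<beta> - \<alpha> * \<alpha> * \<nu> \<in> A" "\<beta> * \<alpha> + \<alpha> * \<beta> + \<alpha> * \<alpha> * \<tau> \<in> A"
      "T * \<beta> - D \<in> A" "T * \<alpha> \<in> A"
      by (rule subring_diff[OF A] subring_add[OF A] subring_mult[OF A] baA TD \<tau> \<nu>)+
    ultimately have "\<beta> * \<alpha> + \<alpha> * \<beta> + \<alpha> * \<alpha> * \<tau> = T * \<alpha>"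
      using basis_unique AK by (metis subsetD)
    then have "\<alpha> * (\<beta> + \<beta> + \<alpha> * \<tau>) = \<alpha> * T" by (simp add: algebra_simps)
    then have "T = \<beta> + \<beta> + \<alpha> * \<tau>" using \<alpha>0 by simp
    then show ?thesis unfolding ba(3) by (simp add: algebra_simps)
  qed
  \<comment> \<open>Dividing \<open>c * \<omega> + d = \<beta> + \<alpha> * \<epsilon>\<close> by
    the constant \<open>\<alpha>\<close>, a unit of \<open>A\<close>, and solving for
    \<open>\<omega>\<close> produces this pair.\<close>
  define s t where "s = i * (\<beta> - d)" and "t = i * c"
  have st: "s \<in> A" "t \<in> A" using i baA abcd by (auto simp: s_def t_def intro!: subring_intros[OF A])
  have t0: "t \<noteq> 0" using c0 i by (auto simp: t_def)
  have es: "\<epsilon> + s = i * (l - d)"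
  proof -
    have "i * (l - d) = (i * \<alpha>) * \<epsilon> + i * (\<beta> - d)" unfolding ba(3) by (simp add: algebra_simps)
    then show ?thesis unfolding i(2) by (simp add: s_def)
  qed
  have wst: "\<omega> = (\<epsilon> + s) / t" unfolding es \<omega> t_def using i by auto
  have norm: "(\<sigma> \<epsilon> + s) * (\<epsilon> + s) = t * (- (i * b))"
  proof -
    have "i * ((T - l) - d) = (i * \<alpha>) * (\<tau> - \<epsilon>) + i * (\<beta> - d)"
      unfolding trace by (simp add: algebra_simps)
    then have conj_s: "\<sigma> \<epsilon> + s = i * ((T - l) - d)" unfolding i(2) \<sigma>_\<epsilon> by (simp add: s_def)
    \<comment> \<open>The bracket is the characteristic polynomial of \<open>g\<close> at
      \<open>d\<close>, which equals \<open>- (b * c)\<close>; this is the source of the cofactor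
      \<open>- (i * b)\<close>.\<close>
    have "(\<sigma> \<epsilon> + s) * (\<epsilon> + s) = i * i * (l * (T - l) - d * T + d * d)"
      unfolding conj_s es by (simp add: algebra_simps)
    also have "\<dots> = t * (- (i * b))"
      unfolding lT by (simp add: D_def T_def t_def algebra_simps)
    finally show ?thesis .
  qed
  have "- (i * b) \<in> A" using i abcd by (auto intro!: subring_intros[OF A])
  then have "elliptic_form \<omega> s t"
    unfolding elliptic_form_def using st t0 by (intro conjI bexI[of _ "- (i * b)"] wst norm) auto
  then show ?thesis by (rule that)
qed

section \<open>Entry ideals of matrices whose determinant divides all products of two
  entries\<close>

context
  fixes M :: "'c^2^2" and \<Delta> :: 'c
  assumes M: "\<forall>i j. M $ i $ j \<in> A" and \<Delta>: "\<Delta> = det M" and \<Delta>0: "\<Delta> \<noteq> 0"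
    and dvd: "\<And>i j k l. M $ i $ j * M $ k $ l / \<Delta> \<in> A"
begin

lemma entry_mem_entry_ideal: "M $ i $ j \<in> entry_ideal A M"
proof -
  have mem: "M $ 1 $ 1 * x + M $ 1 $ 2 * y + M $ 2 $ 1 * z + M $ 2 $ 2 * w \<in> entry_ideal A M"
    if "x \<in> A" "y \<in> A" "z \<in> A" "w \<in> A" for x y z w
    using that by (auto simp: entry_ideal_def)
  note z = subring_zero[OF A] and o = subring_one[OF A]
  show ?thesis
    using exhaust_2[of i] exhaust_2[of j] mem[OF o z z z] mem[OF z o z z] mem[OF z z o z] mem[OF z z z o]
    by auto
qed

lemma entry_ideal_ideal: "ideal (entry_ideal A M) (subring_of A)"
  unfolding ideal_subring_of_iff[OF A]
proof (intro conjI ballI)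
  show "entry_ideal A M \<subseteq> A"
    using M by (auto simp: entry_ideal_def intro!: subring_add[OF A] subring_mult[OF A])
  show "0 \<in> entry_ideal A M"
    using subring_zero[OF A] by (force simp: entry_ideal_def)
  fix u assume "u \<in> entry_ideal A M"
  then obtain x y z w where u: "x \<in> A" "y \<in> A" "z \<in> A" "w \<in> A"
    "u = M $ 1 $ 1 * x + M $ 1 $ 2 * y + M $ 2 $ 1 * z + M $ 2 $ 2 * w"
    by (auto simp: entry_ideal_def)
  show "u + u' \<in> entry_ideal A M" if "u' \<in> entry_ideal A M" for u'
  proof -
    obtain x' y' z' w' where u': "x' \<in> A" "y' \<in> A" "z' \<in> A" "w' \<in> A"
      "u' = M $ 1 $ 1 * x' + M $ 1 $ 2 * y' + M $ 2 $ 1 * z' + M $ 2 $ 2 * w'"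
      using \<open>u' \<in> entry_ideal A M\<close> by (auto simp: entry_ideal_def)
    have "u + u' = M $ 1 $ 1 * (x + x') + M $ 1 $ 2 * (y + y') + M $ 2 $ 1 * (z + z') + M $ 2 $ 2 * (w + w')"
      unfolding u u' by (simp add: algebra_simps)
    then show ?thesis
      unfolding entry_ideal_def using u(1-4) u'(1-4) subring_add[OF A] by blast
  qed
  show "r * u \<in> entry_ideal A M" if "r \<in> A" for r
  proof -
    have "r * u = M $ 1 $ 1 * (r * x) + M $ 1 $ 2 * (r * y) + M $ 2 $ 1 * (r * z) + M $ 2 $ 2 * (r * w)"
      unfolding u by (simp add: algebra_simps)
    then show ?thesis
      unfolding entry_ideal_def using u(1-4) that subring_mult[OF A] by blast
  qed
qed

lemma entry_ideal_nonzero: "entry_ideal A M \<noteq> {0}"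
proof
  assume "entry_ideal A M = {0}"
  then have "M $ i $ j = 0" for i j using entry_mem_entry_ideal[of i j] by simp
  then show False using \<Delta> \<Delta>0 by (simp add: det_2)
qed

lemma entry_ideal_mult_dvd:
  assumes x: "x \<in> entry_ideal A M" and y: "y \<in> entry_ideal A M"
  shows "x * y / \<Delta> \<in> A"
proof -
  \<comment> \<open>Divisibility is extended one factor at a time: \<open>e\<close> is first an
    entry of \<open>M\<close>, then an arbitrary element of the ideal.\<close>
  have *: "e * y / \<Delta> \<in> A"
    if y: "y \<in> entry_ideal A M" and e: "\<And>i j. e * M $ i $ j / \<Delta> \<in> A" for e y
  proof -
    obtain p q r s where u: "p \<in> A" "q \<in> A" "r \<in> A" "s \<in> A"
      "y = M $ 1 $ 1 * p + M $ 1 $ 2 * q + M $ 2 $ 1 * r + M $ 2 $ 2 * s"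
      using y by (auto simp: entry_ideal_def)
    have "e * y / \<Delta> = e * M $ 1 $ 1 / \<Delta> * p + e * M $ 1 $ 2 / \<Delta> * q +
        e * M $ 2 $ 1 / \<Delta> * r + e * M $ 2 $ 2 / \<Delta> * s"
      unfolding u by (simp add: algebra_simps add_divide_distrib)
    then show ?thesis
      using u(1-4) e by (simp only:) (intro subring_add[OF A] subring_mult[OF A]; assumption)
  qed
  have "M $ i $ j * x / \<Delta> \<in> A" for i j by (rule *[OF x dvd])
  then show ?thesis using *[OF y, of x] by (simp add: mult.commute)
qed

lemma entry_genideal_ideal: "ideal (genideal (subring_of At) (entry_ideal A M)) (subring_of At)"
  and entry_ideal_subset_genideal: "entry_ideal A M \<subseteq> genideal (subring_of At) (entry_ideal A M)"
proof -
  interpret R: cring "subring_of At" by (rule cring_subring_of[OF At])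
  have "entry_ideal A M \<subseteq> At"
    using entry_ideal_ideal A_subset_At by (auto simp: ideal_subring_of_iff[OF A])
  then show "ideal (genideal (subring_of At) (entry_ideal A M)) (subring_of At)"
    "entry_ideal A M \<subseteq> genideal (subring_of At) (entry_ideal A M)"
    using R.genideal_ideal R.genideal_self by auto
qed

lemma entry_genideal_nonzero: "genideal (subring_of At) (entry_ideal A M) \<noteq> {0}"
proof
  assume "genideal (subring_of At) (entry_ideal A M) = {0}"
  then have "entry_ideal A M = {} \<or> entry_ideal A M = {0}"
    using entry_ideal_subset_genideal by (simp add: subset_singleton_iff)
  then show False
    using entry_ideal_nonzero entry_mem_entry_ideal[of 1 1] by (elim disjE) simp_all
qed

text \<open>The set \<open>q + q \<epsilon>\<close> is already an ideal of \<open>At\<close>, as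
  \<open>\<epsilon>\<close> satisfies a monic quadratic equation over \<open>A\<close>. The
  coordinates obtained this way feed the norm computation.\<close>

lemma entry_genideal_subset:
  assumes "x \<in> genideal (subring_of At) (entry_ideal A M)"
  obtains a b where "a \<in> entry_ideal A M" "b \<in> entry_ideal A M" "x = a + b * \<epsilon>"
proof -
  interpret R: cring "subring_of At" by (rule cring_subring_of[OF At])
  define q where "q = entry_ideal A M"
  have q: "q \<subseteq> A" "0 \<in> q" "\<And>x y. x \<in> q \<Longrightarrow> y \<in> q \<Longrightarrow> x + y \<in> q" "\<And>r x. r \<in> A \<Longrightarrow> x \<in> q \<Longrightarrow> r * x \<in> q"
    using entry_ideal_ideal by (auto simp: q_def ideal_subring_of_iff[OF A])
  define B where "B = {a + b * \<epsilon> | a b. a \<in> q \<and> b \<in> q}"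
  have BI: "a + b * \<epsilon> \<in> B" if "a \<in> q" "b \<in> q" for a b using that by (auto simp: B_def)
  have "ideal B (subring_of At)"
    unfolding ideal_subring_of_iff[OF At]
  proof (intro conjI ballI)
    show "B \<subseteq> At" using q(1) by (auto simp: B_def intro!: AtI)
    show "0 \<in> B" using BI[OF q(2) q(2)] by simp
    fix u assume "u \<in> B"
    then obtain a b where u: "a \<in> q" "b \<in> q" "u = a + b * \<epsilon>" by (auto simp: B_def)
    show "u + w \<in> B" if wB: "w \<in> B" for w
    proof -
      obtain c d where w: "c \<in> q" "d \<in> q" "w = c + d * \<epsilon>" using wB by (auto simp: B_def)
      have "u + w = (a + c) + (b + d) * \<epsilon>" unfolding u w by (simp add: algebra_simps)
      then show ?thesis using BI[OF q(3)[OF u(1) w(1)] q(3)[OF u(2) w(2)]] by simp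
    qed
    fix r assume "r \<in> At"
    then obtain c d where r: "c \<in> A" "d \<in> A" "r = c + d * \<epsilon>" by (rule AtE)
    have "r * u = (c * a + (- (d * \<nu>)) * b) + (c * b + d * a + (d * \<tau>) * b) * \<epsilon>"
      unfolding r u At_mult by (simp add: algebra_simps)
    then show "r * u \<in> B"
      using u r \<tau> \<nu> by (simp only:) (intro BI q(3,4) subring_uminus[OF A] subring_mult[OF A]; assumption)
  qed
  moreover have "q \<subseteq> B" using BI[OF _ q(2)] by auto
  ultimately have "genideal (subring_of At) q \<subseteq> B" by (rule R.genideal_minimal)
  then show ?thesis using assms that by (auto simp: B_def q_def)
qed

text \<open>Conjugation fixes the entries, so this is \<open>q(M)\<^sup>2 = (det M)\<close> carried
  over to \<open>At\<close>: products of elements of \<open>q\<close> are multiples of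
  \<open>\<Delta>\<close>, and \<open>\<Delta>\<close> is itself a difference of two products of
  entries.\<close>

lemma entry_genideal_norm:
  "genideal (subring_of At) (entry_ideal A M) \<cdot>\<^bsub>subring_of At\<^esub>
     \<sigma> ` genideal (subring_of At) (entry_ideal A M) = (*) \<Delta> ` At"
proof
  define q where "q = entry_ideal A M"
  define I where "I = genideal (subring_of At) q"
  have qA: "q \<subseteq> A" using entry_ideal_ideal by (simp add: q_def ideal_subring_of_iff[OF A])
  have qI: "q \<subseteq> I" using entry_ideal_subset_genideal by (simp add: q_def I_def)
  show "I \<cdot>\<^bsub>subring_of At\<^esub> \<sigma> ` I \<subseteq> (*) \<Delta> ` At"
  proof (rule ideal_prod_subsetI)
    fix i j assume i: "i \<in> I" and "j \<in> \<sigma> ` I"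
    then obtain j' where j': "j' \<in> I" "j = \<sigma> j'" by blast
    obtain a b where ab: "a \<in> q" "b \<in> q" "i = a + b * \<epsilon>"
      using entry_genideal_subset[OF i[unfolded I_def q_def]] unfolding q_def .
    obtain c d where "c \<in> q" "d \<in> q" "j' = c + d * \<epsilon>"
      using entry_genideal_subset[OF j'(1)[unfolded I_def q_def]] unfolding q_def .
    with ab j' have *: "a \<in> q" "b \<in> q" "i = a + b * \<epsilon>" "c \<in> q" "d \<in> q" "j = \<sigma> (c + d * \<epsilon>)"
      by simp_all
    have j: "j = c + d * (\<tau> - \<epsilon>)" using \<sigma>_eq[of c d] * qA by auto
    have "i * j = a * c + (b * c) * \<epsilon> + (a * d) * (\<tau> - \<epsilon>) + (b * d) * (\<epsilon> * (\<tau> - \<epsilon>))"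
      unfolding *(3) j by (simp add: algebra_simps)
    also have "\<dots> = \<Delta> * (a * c / \<Delta> + (b * c / \<Delta>) * \<epsilon> + (a * d / \<Delta>) * (\<tau> - \<epsilon>) + (b * d / \<Delta>) * \<nu>)"
      unfolding \<epsilon>_root using \<Delta>0 by (simp add: distrib_left)
    finally have e: "i * j = \<Delta> * (a * c / \<Delta> + (b * c / \<Delta>) * \<epsilon> + (a * d / \<Delta>) * (\<tau> - \<epsilon>) + (b * d / \<Delta>) * \<nu>)" .
    have "x * y / \<Delta> \<in> At" if "x \<in> q" "y \<in> q" for x y
      using entry_ideal_mult_dvd that A_subset_At by (auto simp: q_def)
    then have "a * c / \<Delta> + (b * c / \<Delta>) * \<epsilon> + (a * d / \<Delta>) * (\<tau> - \<epsilon>) + (b * d / \<Delta>) * \<nu> \<in> At"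
      using * \<nu> A_subset_At
      by (intro subring_add[OF At] subring_mult[OF At] conj_mem \<epsilon>_mem) auto
    then show "i * j \<in> (*) \<Delta> ` At" unfolding e by blast
  next
    fix i j assume "i \<in> (*) \<Delta> ` At" "j \<in> (*) \<Delta> ` At"
    then show "i + j \<in> (*) \<Delta> ` At" using subring_add[OF At] by (auto simp: distrib_left[symmetric])
  qed
  define P where "P = I \<cdot>\<^bsub>subring_of At\<^esub> \<sigma> ` I"
  have Pm: "r * z \<in> P" if "r \<in> At" "z \<in> P" for r z
    using ideal_prod_closed_mult[of At I r z] entry_genideal_ideal that
    by (simp add: P_def I_def q_def ideal_subring_of_iff[OF At])
  have "M $ i $ j * M $ k $ l \<in> P" for i j k l
  proof -
    have "\<sigma> (M $ k $ l) \<in> \<sigma> ` I" "M $ i $ j \<in> I"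
      using entry_mem_entry_ideal qI by (auto simp: q_def)
    then show ?thesis unfolding P_def using M by (auto simp: \<sigma>_A intro: ideal_prod_mult)
  qed
  then have "M $ 1 $ 1 * M $ 2 $ 2 + (- 1) * (M $ 1 $ 2 * M $ 2 $ 1) \<in> P"
    using Pm[of "- 1"] subring_uminus[OF At subring_one[OF At]] ideal_prod_add unfolding P_def by blast
  then have "\<Delta> \<in> P" by (simp add: \<Delta> det_2)
  then have "\<Delta> * r \<in> P" if "r \<in> At" for r using Pm[OF that] by (metis mult.commute)
  then show "(*) \<Delta> ` At \<subseteq> I \<cdot>\<^bsub>subring_of At\<^esub> \<sigma> ` I" by (auto simp: P_def)
qed

text \<open>
  Solving for \<open>u\<close> and \<open>t\<close> by Cramer's rule, \<open>\<Delta> u = d p1 - b p2\<close> and \<open>\<Delta> t = a p2 - c p1\<close>, and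
  every \<open>x d / \<Delta>\<close> etc. with \<open>x\<close> in the entry ideal is integral.
\<close>

lemma entry_genideal_mult_lattice:
  assumes J: "ideal (lattice u t) (subring_of At)"
    and p1: "p1 = M $ 1 $ 1 * u + M $ 1 $ 2 * t" and p2: "p2 = M $ 2 $ 1 * u + M $ 2 $ 2 * t"
  shows "genideal (subring_of At) (entry_ideal A M) \<cdot>\<^bsub>subring_of At\<^esub> lattice u t = lattice p1 p2"
proof
  interpret R: cring "subring_of At" by (rule cring_subring_of[OF At])
  define q where "q = entry_ideal A M"
  define I where "I = genideal (subring_of At) q"
  define a b c d where "a = M $ 1 $ 1" and "b = M $ 1 $ 2" and "c = M $ 2 $ 1" and "d = M $ 2 $ 2"
  have \<Delta>_eq: "\<Delta> = a * d - b * c" by (simp add: \<Delta> det_2 a_def b_def c_def d_def)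
  have J': "lattice u t \<subseteq> At" "\<And>r j. r \<in> At \<Longrightarrow> j \<in> lattice u t \<Longrightarrow> r * j \<in> lattice u t"
    using J by (auto simp: ideal_subring_of_iff[OF At])
  have qJ: "x * j \<in> lattice p1 p2" if x: "x \<in> q" and j: "j \<in> lattice u t" for x j
  proof -
    obtain m n where mn: "m \<in> A" "n \<in> A" "j = m * u + n * t" using j by (auto simp: lattice_def)
    have D: "x * e / \<Delta> \<in> A" if "e \<in> {a, b, c, d}" for e
      using entry_ideal_mult_dvd[OF x[unfolded q_def], of e] entry_mem_entry_ideal that
      by (auto simp: a_def b_def c_def d_def)
    have "d * p1 - b * p2 = \<Delta> * u" "a * p2 - c * p1 = \<Delta> * t"
      by (simp_all add: p1 p2 \<Delta>_eq a_def b_def c_def d_def algebra_simps)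
    then have u: "u = (d * p1 - b * p2) / \<Delta>" and t: "t = (a * p2 - c * p1) / \<Delta>"
      using \<Delta>0 by simp_all
    have "x * u = (x * d / \<Delta>) * p1 + (- (x * b / \<Delta>)) * p2"
      by (subst u) (simp add: diff_divide_distrib algebra_simps)
    moreover have "x * t = (- (x * c / \<Delta>)) * p1 + (x * a / \<Delta>) * p2"
      by (subst t) (simp add: diff_divide_distrib algebra_simps)
    ultimately have "x * u \<in> lattice p1 p2" "x * t \<in> lattice p1 p2"
      by (simp_all only:) (rule latticeI subring_uminus[OF A] D insertI1 insertI2)+
    then have "m * (x * u) + n * (x * t) \<in> lattice p1 p2"
      using mn by (simp add: lattice_add lattice_smult)
    then show ?thesis using mn by (simp add: algebra_simps)
  qed
  \<comment> \<open>Multipliers carrying \<open>lattice u t\<close> into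
    \<open>lattice p1 p2\<close> form an ideal of \<open>At\<close> because the source lattice is
    one, so it suffices to test elements of \<open>q\<close>. Nothing is presupposed about the
    target lattice beyond its closure under addition.\<close>
  define B where "B = {x \<in> At. \<forall>j\<in>lattice u t. x * j \<in> lattice p1 p2}"
  have "ideal B (subring_of At)"
    unfolding ideal_subring_of_iff[OF At]
  proof (intro conjI ballI)
    show "0 \<in> B" using subring_zero[OF At] latticeI[OF subring_zero[OF A] subring_zero[OF A]]
      by (auto simp: B_def)
    fix x assume x: "x \<in> B"
    show "x + y \<in> B" if "y \<in> B" for y
      using x that by (auto simp: B_def distrib_right intro: subring_add[OF At] lattice_add)
    fix r assume r: "r \<in> At"
    have "r * x * j \<in> lattice p1 p2" if "j \<in> lattice u t" for j
    proof -
      have "x * (r * j) \<in> lattice p1 p2" using x J'(2)[OF r that] by (auto simp: B_def)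
      then show ?thesis by (simp add: mult_ac)
    qed
    then show "r * x \<in> B" using x r subring_mult[OF At] by (auto simp: B_def)
  qed (auto simp: B_def)
  moreover have "q \<subseteq> B"
    using qJ entry_ideal_ideal A_subset_At by (auto simp: B_def q_def ideal_subring_of_iff[OF A])
  ultimately have "I \<subseteq> B" unfolding I_def by (rule R.genideal_minimal)
  then show "I \<cdot>\<^bsub>subring_of At\<^esub> lattice u t \<subseteq> lattice p1 p2"
    by (intro ideal_prod_subsetI lattice_add) (auto simp: B_def)
  define P where "P = I \<cdot>\<^bsub>subring_of At\<^esub> lattice u t"
  have MI: "M $ i $ j \<in> I" for i j
    using entry_mem_entry_ideal entry_ideal_subset_genideal by (auto simp: I_def q_def)
  have "p1 \<in> P" "p2 \<in> P"
    unfolding p1 p2 P_def by (intro ideal_prod_add ideal_prod_mult MI lattice_mem)+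
  moreover have "r * z \<in> P" if "r \<in> At" "z \<in> P" for r z
    using ideal_prod_closed_mult[of At I r z] entry_genideal_ideal that
    by (simp add: P_def I_def q_def ideal_subring_of_iff[OF At])
  ultimately have "x * p1 + y * p2 \<in> P" if "x \<in> A" "y \<in> A" for x y
    using that A_subset_At ideal_prod_add unfolding P_def by blast
  then show "lattice p1 p2 \<subseteq> I \<cdot>\<^bsub>subring_of At\<^esub> lattice u t"
    by (auto simp: lattice_def P_def)
qed

text \<open>The image of \<open>\<omega>\<close> has the two presentations \<open>p1 / p2\<close>
  and \<open>(\<epsilon> + s') / t'\<close>, so the corresponding lattices become equal after
  scaling by \<open>t'\<close> and \<open>p2\<close>.\<close>

lemma moebius_ideal_class:
  assumes w: "elliptic_form \<omega> s t" and w': "elliptic_form (moebius_action M \<omega>) s' t'"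
  shows "ideal_class At (lattice (\<epsilon> + s') t') =
    ideal_class At (genideal (subring_of At) (entry_ideal A M) \<cdot>\<^bsub>subring_of At\<^esub> lattice (\<epsilon> + s) t)"
proof -
  define u p1 p2 where "u = \<epsilon> + s" and "p1 = M $ 1 $ 1 * u + M $ 1 $ 2 * t"
    and "p2 = M $ 2 $ 1 * u + M $ 2 $ 2 * t"
  have st: "s \<in> A" "t \<in> A" "t \<noteq> 0" "\<omega> = u / t" using w by (auto simp: elliptic_form_def u_def)
  have st': "s' \<in> A" "t' \<in> A" "t' \<noteq> 0" "moebius_action M \<omega> = (\<epsilon> + s') / t'"
    using w' by (auto simp: elliptic_form_def)
  have p2_eq: "p2 = (M $ 2 $ 1 * s + M $ 2 $ 2 * t) + M $ 2 $ 1 * \<epsilon>"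
    by (simp add: p2_def u_def algebra_simps)
  have mem: "M $ 2 $ 1 * s + M $ 2 $ 2 * t \<in> A" "M $ 2 $ 1 \<in> A"
    using M st by (auto intro!: subring_intros[OF A])
  have p2At: "p2 \<in> At" unfolding p2_eq using mem by (rule AtI)
  have p20: "p2 \<noteq> 0"
  proof
    assume "p2 = 0"
    then have "M $ 2 $ 1 * s + M $ 2 $ 2 * t = 0 \<and> M $ 2 $ 1 = 0"
      unfolding p2_eq using mem AK by (intro basis_zero) auto
    then show False using \<Delta>0 st(3) by (auto simp: \<Delta> det_2)
  qed
  have "moebius_action M \<omega> = p1 / p2"
  proof -
    have "p1 = t * (M $ 1 $ 1 * \<omega> + M $ 1 $ 2)" "p2 = t * (M $ 2 $ 1 * \<omega> + M $ 2 $ 2)"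
      using st by (simp_all add: p1_def p2_def distrib_left)
    then show ?thesis using st(3) by (simp add: moebius_action_def)
  qed
  then have cross: "p2 * (\<epsilon> + s') = t' * p1"
    using st' p20 by (simp add: field_simps)
  have "(*) p2 ` lattice (\<epsilon> + s') t' = lattice (t' * p1) (t' * p2)"
    unfolding lattice_scale cross by (simp add: mult.commute)
  also have "\<dots> = (*) t' ` lattice p1 p2" by (simp add: lattice_scale)
  also have "lattice p1 p2 =
      genideal (subring_of At) (entry_ideal A M) \<cdot>\<^bsub>subring_of At\<^esub> lattice (\<epsilon> + s) t"
    using entry_genideal_mult_lattice[OF elliptic_lattice_ideal[OF w]] by (simp add: p1_def p2_def u_def)
  finally show ?thesis
    using p2At p20 st' A_subset_At by (intro ideal_class_eqI[OF At, of p2 t']) auto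
qed

end

end

section \<open>Arithmetic of the quadratic constant field extension\<close>

lemma quadratic_extension_constants:
  fixes F K A Kt At :: "'c::field set"
  assumes F: "subfield F ambient" and fin: "finite F" and K: "subfield K ambient"
    and const: "full_constant_field F K"
    and A: "subring A ambient" and FA: "F \<subseteq> A" and AK: "A \<subseteq> K"
    and Kt: "Kt = generate_field ambient (K \<union> quadratic_constants F)"
    and At: "At = generate_ring ambient (A \<union> quadratic_constants F)"
    and \<sigma>: "nontrivial_automorphism K Kt \<sigma>"
    and \<epsilon>: "\<epsilon> \<in> quadratic_constants F - F"
  shows "quadratic_extension K A At \<sigma> \<epsilon> (\<epsilon> + \<epsilon> ^ card F) (\<epsilon> * \<epsilon> ^ card F)"
proof -
  define \<tau> \<nu> where "\<tau> = \<epsilon> + \<epsilon> ^ card F" and "\<nu> = \<epsilon> * \<epsilon> ^ card F"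
  have tn: "\<tau> \<in> F" "\<nu> \<in> F"
    using quadratic_constants_trace_norm[OF F fin] \<epsilon> by (auto simp: \<tau>_def \<nu>_def)
  then have tnA: "\<tau> \<in> A" "\<nu> \<in> A" and tnK: "\<tau> \<in> K" "\<nu> \<in> K" using FA AK by auto
  have root: "\<epsilon> * (\<tau> - \<epsilon>) = \<nu>" by (simp add: \<tau>_def \<nu>_def)
  then have sq: "\<epsilon> * \<epsilon> = \<tau> * \<epsilon> - \<nu>" by (simp add: algebra_simps)
  note Fr = subfield_subring[OF F] and Kr = subfield_subring[OF K]
  have \<epsilon>K: "\<epsilon> \<notin> K"
  proof
    assume "\<epsilon> \<in> K"
    moreover have "ring.algebraic ambient F \<epsilon>"
    proof (rule algebraic_ambientI)
      show "[:\<nu>, - \<tau>, 1:] \<noteq> 0" by simp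
      show "poly [:\<nu>, - \<tau>, 1:] \<epsilon> = 0" using sq by (simp add: algebra_simps)
      show "Polynomial.coeff [:\<nu>, - \<tau>, 1:] i \<in> F" for i
        using tn subring_zero[OF Fr] subring_one[OF Fr] subring_uminus[OF Fr]
        by (auto simp: coeff_pCons split: nat.split)
    qed
    ultimately have "\<epsilon> \<in> F" using const unfolding full_constant_field_def by blast
    then show False using \<epsilon> by simp
  qed
  have Q_sub: "\<exists>a b. a \<in> S \<and> b \<in> S \<and> x = a + b * \<epsilon>"
    if "x \<in> quadratic_constants F" "F \<subseteq> S" for x S
    using quadratic_constants_span[OF F fin \<epsilon> that(1)] that(2) by (metis subsetD)
  have mult: "(a + b * \<epsilon>) * (c + d * \<epsilon>) = (a * c - b * d * \<nu>) + (a * d + b * c + b * d * \<tau>) * \<epsilon>"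
    for a b c d
  proof -
    have "(a + b * \<epsilon>) * (c + d * \<epsilon>) = a * c + (a * d + b * c) * \<epsilon> + b * d * (\<epsilon> * \<epsilon>)"
      by (simp add: algebra_simps)
    then show ?thesis unfolding sq by (simp add: algebra_simps)
  qed
  \<comment> \<open>Stated for a general subring \<open>S\<close> because it serves both for
    \<open>S = A\<close>, describing \<open>At\<close>, and for \<open>S = K\<close>, describing
    \<open>Kt\<close>.\<close>
  have comb_closed:
    "- x \<in> {a + b * \<epsilon> | a b. a \<in> S \<and> b \<in> S}"
    "x + y \<in> {a + b * \<epsilon> | a b. a \<in> S \<and> b \<in> S}"
    "x * y \<in> {a + b * \<epsilon> | a b. a \<in> S \<and> b \<in> S}"
    if S: "subring S ambient" "F \<subseteq> S" and xy: "x \<in> {a + b * \<epsilon> | a b. a \<in> S \<and> b \<in> S}"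
      "y \<in> {a + b * \<epsilon> | a b. a \<in> S \<and> b \<in> S}" for S x y
  proof -
    obtain a b c d where *: "a \<in> S" "b \<in> S" "c \<in> S" "d \<in> S" "x = a + b * \<epsilon>" "y = c + d * \<epsilon>"
      using xy by blast
    have "- x = - a + (- b) * \<epsilon>" "x + y = (a + c) + (b + d) * \<epsilon>"
      unfolding * by (simp_all add: algebra_simps)
    moreover have "- a \<in> S" "- b \<in> S" "a + c \<in> S" "b + d \<in> S"
      "a * c - b * d * \<nu> \<in> S" "a * d + b * c + b * d * \<tau> \<in> S"
      using * tn S(2) by (auto intro!: subring_intros[OF S(1)])
    ultimately show "- x \<in> {a + b * \<epsilon> | a b. a \<in> S \<and> b \<in> S}"
      "x + y \<in> {a + b * \<epsilon> | a b. a \<in> S \<and> b \<in> S}"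
      "x * y \<in> {a + b * \<epsilon> | a b. a \<in> S \<and> b \<in> S}"
      using mult[of a b c d] *(5,6) by blast+
  qed
  have comb_incl: "h \<in> {a + b * \<epsilon> | a b. a \<in> S \<and> b \<in> S}"
    if S: "subring S ambient" "F \<subseteq> S" and "h \<in> S \<union> quadratic_constants F" for S h
  proof (cases "h \<in> S")
    case True
    then show ?thesis using subring_zero[OF S(1)] by (intro CollectI exI[of _ h] exI[of _ 0]) auto
  next
    case False
    then show ?thesis using that Q_sub[of h S] by blast
  qed
  have comb_one: "1 \<in> {a + b * \<epsilon> | a b. a \<in> S \<and> b \<in> S}" if S: "subring S ambient" "F \<subseteq> S" for S
    using comb_incl[OF S] subring_one[OF S(1)] by blast
  have At_eq: "At = {a + b * \<epsilon> | a b. a \<in> A \<and> b \<in> A}"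
  proof
    show "At \<subseteq> {a + b * \<epsilon> | a b. a \<in> A \<and> b \<in> A}"
    proof
      fix x assume "x \<in> At"
      then show "x \<in> {a + b * \<epsilon> | a b. a \<in> A \<and> b \<in> A}"
        unfolding At
      proof induction
        case one
        then show ?case using comb_one[OF A FA] by simp
      next
        case (incl h)
        then show ?case by (rule comb_incl[OF A FA])
      next
        case (a_inv h)
        then show ?case using comb_closed(1)[OF A FA] by simp
      next
        case (eng_add g h)
        then show ?case using comb_closed(2)[OF A FA] by simp
      next
        case (eng_mult g h)
        then show ?case using comb_closed(3)[OF A FA] by simp
      qed
    qed
    have "a + b * \<epsilon> \<in> At" if "a \<in> A" "b \<in> A" for a b
      using generate_ring.eng_add[of a ambient _ "b * \<epsilon>"] generate_ring.eng_mult[of b ambient _ \<epsilon>]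
        generate_ring.incl[of _ "A \<union> quadratic_constants F" ambient] that \<epsilon>
      by (auto simp: At)
    then show "{a + b * \<epsilon> | a b. a \<in> A \<and> b \<in> A} \<subseteq> At" by blast
  qed
  have FK: "F \<subseteq> K" using FA AK by simp
  have Kt_sub: "x \<in> {a + b * \<epsilon> | a b. a \<in> K \<and> b \<in> K}" if "x \<in> Kt" for x
    using that unfolding Kt
  proof induction
    case one
    then show ?case using comb_one[OF Kr FK] by simp
  next
    case (incl h)
    then show ?case by (rule comb_incl[OF Kr FK])
  next
    case (a_inv h)
    then show ?case using comb_closed(1)[OF Kr FK] by simp
  next
    case (eng_add g h)
    then show ?case using comb_closed(2)[OF Kr FK] by simp
  next
    case (eng_mult g h)
    then show ?case using comb_closed(3)[OF Kr FK] by simp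
  next
    case (m_inv h)
    then obtain a b where ab: "a \<in> K" "b \<in> K" "h = a + b * \<epsilon>" by blast
    have h0: "h \<noteq> 0" using m_inv by simp
    \<comment> \<open>\<open>g\<close> is the conjugate of \<open>h\<close>, so \<open>h * g\<close>
      is a norm and lies in \<open>K\<close>; inverses therefore stay in the span of 1 and
      \<open>\<epsilon>\<close>.\<close>
    define g where "g = (a + b * \<tau>) + (- b) * \<epsilon>"
    have aK: "a + b * \<tau> \<in> K" using ab tnK by (auto intro!: subring_intros[OF Kr])
    have g0: "g \<noteq> 0"
    proof
      assume "g = 0"
      then have be: "b * \<epsilon> = a + b * \<tau>" by (simp add: g_def algebra_simps)
      then have "b = 0"
        using \<epsilon>K subfield_divide[OF K aK ab(2)] by (metis nonzero_mult_div_cancel_left)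
      then show False using be ab(3) h0 by simp
    qed
    define n where "n = h * g"
    have "n = a * a + a * b * \<tau> + b * b * (\<epsilon> * (\<tau> - \<epsilon>))"
      unfolding n_def g_def ab(3) by (simp add: algebra_simps)
    then have nK: "n \<in> K"
      unfolding root using ab tnK by (auto intro!: subring_add[OF Kr] subring_mult[OF Kr])
    have "inverse h = g / n" using h0 g0 by (simp add: n_def field_simps)
    also have "\<dots> = (a + b * \<tau>) / n + (- b / n) * \<epsilon>"
      by (simp add: g_def add_divide_distrib diff_divide_distrib)
    finally have "inverse h = (a + b * \<tau>) / n + (- b / n) * \<epsilon>" .
    moreover have "(a + b * \<tau>) / n \<in> K" "- b / n \<in> K"
      using aK nK ab by (auto intro!: subfield_divide[OF K] subring_uminus[OF Kr])
    ultimately have "inverse h \<in> {a + b * \<epsilon> | a b. a \<in> K \<and> b \<in> K}" by blast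
    then show ?case unfolding ambient_m_inv[OF h0] .
  qed
  have KKt: "x \<in> Kt" if "x \<in> K" for x using that unfolding Kt by (auto intro: generate_field.incl)
  have \<epsilon>Kt: "\<epsilon> \<in> Kt" using \<epsilon> unfolding Kt by (auto intro: generate_field.incl)
  have multKt: "x * y \<in> Kt" if "x \<in> Kt" "y \<in> Kt" for x y
    using that generate_field.eng_mult[of x ambient _ y] by (auto simp: Kt)
  have hom: "\<sigma> (x + y) = \<sigma> x + \<sigma> y" "\<sigma> (x * y) = \<sigma> x * \<sigma> y" if "x \<in> Kt" "y \<in> Kt" for x y
    using \<sigma> that ring_hom_add[of \<sigma> "subring_of Kt" "subring_of Kt" x y]
      ring_hom_mult[of \<sigma> "subring_of Kt" "subring_of Kt" x y]
    by (auto simp: nontrivial_automorphism_def ring_iso_def)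
  have \<sigma>K: "\<sigma> x = x" if "x \<in> K" for x
    using \<sigma> that by (auto simp: nontrivial_automorphism_def)
  have \<sigma>_comb: "\<sigma> (a + b * \<epsilon>) = a + b * \<sigma> \<epsilon>" if "a \<in> K" "b \<in> K" for a b
    using that by (simp add: hom multKt KKt \<epsilon>Kt \<sigma>K)
  \<comment> \<open>The image of \<open>\<epsilon>\<close> is a root of the same quadratic equation.
    It cannot be \<open>\<epsilon>\<close> itself, for then \<open>\<sigma>\<close> would be the
    identity on all of \<open>Kt\<close>.\<close>
  have "\<sigma> \<epsilon> = \<tau> - \<epsilon>"
  proof -
    have "\<sigma> (\<epsilon> * \<epsilon>) = \<sigma> (- \<nu> + \<tau> * \<epsilon>)" unfolding sq by (simp add: algebra_simps)
    then have "\<sigma> \<epsilon> * \<sigma> \<epsilon> = - \<nu> + \<tau> * \<sigma> \<epsilon>"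
      using \<sigma>_comb[OF subring_uminus[OF Kr tnK(2)] tnK(1)] by (simp add: hom \<epsilon>Kt)
    moreover have "(\<sigma> \<epsilon> - \<epsilon>) * (\<sigma> \<epsilon> - (\<tau> - \<epsilon>)) = \<sigma> \<epsilon> * \<sigma> \<epsilon> - \<tau> * \<sigma> \<epsilon> + \<epsilon> * (\<tau> - \<epsilon>)"
      by (simp add: algebra_simps)
    ultimately have "(\<sigma> \<epsilon> - \<epsilon>) * (\<sigma> \<epsilon> - (\<tau> - \<epsilon>)) = 0" unfolding root by simp
    moreover have "\<sigma> \<epsilon> \<noteq> \<epsilon>"
    proof
      assume fix_\<epsilon>: "\<sigma> \<epsilon> = \<epsilon>"
      obtain x where x: "x \<in> Kt" "\<sigma> x \<noteq> x" using \<sigma> by (auto simp: nontrivial_automorphism_def)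
      then show False using Kt_sub[OF x(1)] \<sigma>_comb fix_\<epsilon> by auto
    qed
    ultimately show ?thesis by simp
  qed
  then have \<sigma>_eq: "\<sigma> (a + b * \<epsilon>) = a + b * (\<tau> - \<epsilon>)" if "a \<in> A" "b \<in> A" for a b
    using \<sigma>_comb[of a b] that AK by auto
  have "\<exists>w\<in>At. w * (\<epsilon> - (\<tau> - \<epsilon>)) = 1"
  proof -
    define q where "q = card F"
    have ee: "(\<epsilon> ^ q) ^ q = \<epsilon>" using \<epsilon> mem_quadratic_constants_iff[OF F fin] by (simp add: q_def)
    \<comment> \<open>The difference of \<open>\<epsilon>\<close> and its conjugate is a nonzero
      element of the quadratic constant field, so its inverse is again a constant and belongs to
      \<open>At\<close>.\<close>
    define w where "w = inverse (\<epsilon> - \<epsilon> ^ q)"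
    have ne: "\<epsilon> - \<epsilon> ^ q \<noteq> 0" using \<epsilon> mem_finite_subfield_iff[OF F fin, of \<epsilon>] by (auto simp: q_def)
    have "((\<epsilon> - \<epsilon> ^ q) ^ q) ^ q = \<epsilon> - \<epsilon> ^ q"
      unfolding q_def finite_subfield_frobenius_diff[OF F fin]
      unfolding q_def[symmetric] ee ..
    then have "w \<in> quadratic_constants F"
      unfolding mem_quadratic_constants_iff[OF F fin] w_def q_def by (simp add: power_inverse)
    then have "w \<in> At" using At_eq Q_sub[OF _ FA] by blast
    moreover have "w * (\<epsilon> - (\<tau> - \<epsilon>)) = 1" using ne by (simp add: w_def \<tau>_def q_def)
    ultimately show ?thesis by blast
  qed
  then show ?thesis
    unfolding \<tau>_def[symmetric] \<nu>_def[symmetric]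
    by (intro quadratic_extension.intro K A AK tnA root \<epsilon>K At_eq \<sigma>_eq)
qed

theorem theorem4p7:
  fixes F K Vinf Kinf Kbar A Kt At :: "'c::field set"
    and v :: "'c \<Rightarrow> real"
    and \<delta> :: nat
    and \<sigma> :: "'c \<Rightarrow> 'c"
    and \<epsilon> \<omega> :: 'c
    and M :: "'c^2^2"
  assumes "function_field F K" and "full_constant_field F K" and "finite F"
    and "place F K Vinf" and "has_place_degree F Vinf \<delta>" and "odd \<delta>"
    and "A = integral_outside F K Vinf"
    and "nonarch_absolute_value v" and "{x\<in>K. v x \<le> 1} = Vinf"
    and "is_completion v K Kinf"
    and "algebraic_closure (subring_of Kbar) Kinf"
    and "is_completion v Kbar UNIV"
    and "Kt = generate_field ambient (K \<union> quadratic_constants F)"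
    and "At = generate_ring ambient (A \<union> quadratic_constants F)"
    and "nontrivial_automorphism K Kt \<sigma>"
    and "\<epsilon> \<in> quadratic_constants F - F"
    and "M \<in> normalizer (GL2 K) (carrier (GL2 A))"
    and "\<forall>i j. M $ i $ j \<in> A"
    and "elliptic A Kinf \<omega>"
  shows
    "ideal_class At (elliptic_ideal A \<sigma> \<epsilon> (moebius_action M \<omega>)) =
       ideal_class At (genideal (subring_of At) (entry_ideal A M)
         \<cdot>\<^bsub>subring_of At\<^esub> elliptic_ideal A \<sigma> \<epsilon> \<omega>)
     \<and> ideal_class At (genideal (subring_of At) (entry_ideal A M)
         \<cdot>\<^bsub>subring_of At\<^esub> elliptic_ideal A \<sigma> \<epsilon> \<omega>) =
       class_extension At (ideal_class A (entry_ideal A M))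
         \<otimes>\<^bsub>class_group At\<^esub> ideal_class At (elliptic_ideal A \<sigma> \<epsilon> \<omega>)
     \<and> {ideal_class At (elliptic_ideal A \<sigma> \<epsilon> (moebius_action M \<omega>)),
        class_extension At (ideal_class A (entry_ideal A M)),
        ideal_class At (elliptic_ideal A \<sigma> \<epsilon> \<omega>)}
       \<subseteq> kernel (class_group At) (class_group A) (class_norm A At \<sigma>)"
proof -
  have F: "subfield F ambient" and K: "subfield K ambient" and FK: "F \<subseteq> K"
    using assms(1) by (auto simp: function_field_def)
  have A: "subring A ambient" unfolding assms(7) by (rule subring_integral_outside[OF K])
  have FA: "F \<subseteq> A" and AK: "A \<subseteq> K"
    using FK by (auto simp: assms(7) integral_outside_def place_def)
  have E: "subfield Kinf ambient" and KE: "K \<subseteq> Kinf"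
    and complete: "Metric_space.mcomplete Kinf (\<lambda>x y. v (x - y))"
    using assms(10) by (auto simp: is_completion_def)
  note v = assms(8)
  have const: "x \<in> F" if "x \<in> A" "v x \<le> 1" for x
  proof (rule constant_of_integral_everywhere[OF assms(1,2)])
    show "x \<in> K" using that AK by auto
    then have "x \<in> Vinf" using that assms(9) by auto
    then show "x \<in> V" if "place F K V" for V
      using that \<open>x \<in> A\<close> by (cases "V = Vinf") (auto simp: assms(7) integral_outside_def)
  qed
  have vF: "v x \<le> 1" if "x \<in> F" for x
    using that assms(4,9) by (auto simp: place_def)
  \<comment> \<open>Of a unit of \<open>A\<close> and its inverse, one lies in the valuation ring at
    infinity and is therefore a constant; then both are constants, of absolute value at most 1 and
    with product 1.\<close>
  have units: "v x = 1" if xy: "x \<in> A" "y \<in> A" "x * y = 1" for x y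
  proof -
    have vxy: "v x * v y = 1" using nonarch_absolute_valueD(3,5)[OF v] xy(3) by metis
    have "y = inverse x" "x = inverse y" using xy(3) by (metis inverse_unique mult.commute)+
    have "x \<in> Vinf \<or> y \<in> Vinf"
      using assms(4) xy(1) AK \<open>y = inverse x\<close> by (auto simp: place_def)
    then have "v x \<le> 1 \<or> v y \<le> 1" using assms(9) by auto
    then have "x \<in> F \<or> y \<in> F" using const xy by auto
    then have "x \<in> F" "y \<in> F"
      using subfield_inverse[OF F] \<open>y = inverse x\<close> \<open>x = inverse y\<close> by metis+
    then have "v x \<le> 1" "v y \<le> 1" using vF by auto
    then show ?thesis
      using vxy nonarch_absolute_valueD(1)[OF v, of x] mult_left_le[of "v y" "v x"] by linarith
  qed
  interpret quadratic_extension K A At \<sigma> \<epsilon> "\<epsilon> + \<epsilon> ^ card F" "\<epsilon> * \<epsilon> ^ card F"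
    by (rule quadratic_extension_constants[OF F assms(3) K assms(2) A FA AK assms(13-16)])
  obtain N :: "'c^2^2" where MK: "\<forall>i j. M $ i $ j \<in> K" and NK: "\<forall>i j. N $ i $ j \<in> K"
    and inv: "N ** M = mat 1" "M ** N = mat 1"
    and conj: "\<And>g. g \<in> carrier (GL2 A) \<Longrightarrow> M ** g ** N \<in> carrier (GL2 A)"
    using normalizer_GL2_conj[OF AK assms(17)] by blast
  have form: "\<exists>s t. elliptic_form \<rho> s t" if "elliptic A Kinf \<rho>" for \<rho>
    by (rule elliptic_form_exists[OF F assms(3) FA assms(16) E KE v complete _ _ that])
      (use const units in metis)+
  obtain s t where w: "elliptic_form \<omega> s t" using form[OF assms(19)] by blast
  have "elliptic A Kinf (moebius_action M \<omega>)"
    using MK NK KE AK by (intro elliptic_moebius_action[OF E _ _ _ inv conj assms(19)]) auto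
  then obtain s' t' where w': "elliptic_form (moebius_action M \<omega>) s' t'" using form by blast
  have "det M * det N = 1" using inv(2) det_mul[of M N] by (simp add: det_I)
  then have D0: "det M \<noteq> 0" by auto
  have dvd: "M $ i $ j * M $ k $ l / det M \<in> A" for i j k l
    by (rule det_dvd_entry_products[OF A inv conj])
  note M = assms(18) refl[of "det M"] D0 dvd
  have detA: "det M \<in> A - {0}" using det_mem_subring[OF A assms(18)] D0 by simp
  have t: "t \<in> A - {0}" "t' \<in> A - {0}" using w w' by (auto simp: elliptic_form_def)
  have ext: "class_extension At (ideal_class A (entry_ideal A M)) =
      ideal_class At (genideal (subring_of At) (entry_ideal A M))"
    by (rule class_extension_eq[OF A At A_subset_At entry_ideal_ideal[OF M] entry_ideal_nonzero[OF M]])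
  note J = elliptic_lattice_ideal[OF w] elliptic_lattice_nonzero[OF w]
    and J' = elliptic_lattice_ideal[OF w'] elliptic_lattice_nonzero[OF w']
    and q = entry_genideal_ideal[OF M] entry_genideal_nonzero[OF M]
  show ?thesis
    unfolding elliptic_ideal_eq[OF w] elliptic_ideal_eq[OF w'] ext class_mult_eq[OF At q J]
    using moebius_ideal_class[OF M w w']
      ideal_class_mem_kernel[OF J t(1) elliptic_lattice_norm[OF w]]
      ideal_class_mem_kernel[OF J' t(2) elliptic_lattice_norm[OF w']]
      ideal_class_mem_kernel[OF q detA entry_genideal_norm[OF M]]
    by blast
qed

end
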